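(* Let $X$ be a Banach space with a Schauder basis $\{x_n\}$. If $E(X,(x_n))\leq_B \mathbb{R}^{\mathbb{N}}/c_0$, then $E(X,(x_n))\sim_B \mathbb{R}^{\mathbb{N}}/c_0$. Likewise, if $E(X,(x_n))\leq_B \mathbb{R}^{\mathbb{N}}/l_1$, then $E(X,(x_n))\sim_B \mathbb{R}^{\mathbb{N}}/l_1$.
   Context: $\mathbb{N}=\{0,1,2,\ldots\}$; Banach spaces are over $\mathbb{R}$. For a basic sequence $\{x_n\}$ in a Banach space $X$ (a Schauder basis, indexed by $\mathbb{N}$, of its closed linear span), $\mathrm{coef}(X,(x_n))$ is the set of all $a=(a_n)\in\mathbb{R}^{\mathbb{N}}$ such that $\sum_n a_nx_n$ converges in $X$, and $E(X,(x_n))$ is the (Borel) equivalence relation on $\mathbb{R}^{\mathbb{N}}$ given by $(x,y)\in E(X,(x_n)) \iff x-y\in \mathrm{coef}(X,(x_n))$; it depends only on $\{x_n\}$ and the norm on its closed linear span. $\mathbb{R}^{\mathbb{N}}/l_1$ and $\mathbb{R}^{\mathbb{N}}/c_0$ denote the equivalence relations on $\mathbb{R}^{\mathbb{N}}$ given by $x-y\in l_1$, respectively $x-y\in c_0$. For equivalence relations $E,F$ on Polish spaces $P,Q$, $E\leq_B F$ means that there is a Borel $\theta:P\to Q$ with $xEy\iff\theta(x)F\theta(y)$ for all $x,y\in P$; $E\sim_B F$ means $E\leq_B F$ and $F\leq_B E$. *)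

theory Defs
  imports "HOL-Analysis.Analysis"
begin

definition schauder_basis :: "(nat \<Rightarrow> 'a::banach) \<Rightarrow> bool" where
  "schauder_basis x \<longleftrightarrow> (\<forall>v. \<exists>!a::nat \<Rightarrow> real. (\<lambda>n. a n *\<^sub>R x n) sums v)"

definition coef :: "(nat \<Rightarrow> 'a::banach) \<Rightarrow> (nat \<Rightarrow> real) set" where
  "coef x = {a. summable (\<lambda>n. a n *\<^sub>R x n)}"

definition c0_space :: "(nat \<Rightarrow> real) set" where
  "c0_space = {a. a \<longlonglongrightarrow> 0}"

definition l1_space :: "(nat \<Rightarrow> real) set" where
  "l1_space = {a. summable (\<lambda>n. \<bar>a n\<bar>)}"

definition RN_mod :: "(nat \<Rightarrow> real) set \<Rightarrow> (nat \<Rightarrow> real) rel" where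
  "RN_mod L = {(x, y). (\<lambda>n. x n - y n) \<in> L}"

definition basis_equiv :: "(nat \<Rightarrow> 'a::banach) \<Rightarrow> (nat \<Rightarrow> real) rel" where
  "basis_equiv x = RN_mod (coef x)"

(* On type nat \<Rightarrow> real, borel is generated by the product topology,
   for which the type is an instance of class polish_space. *)
definition borel_reducible :: "'p::polish_space rel \<Rightarrow> 'q::polish_space rel \<Rightarrow> bool"
    (infix "\<le>\<^sub>B" 50) where
  "E \<le>\<^sub>B F \<longleftrightarrow> (\<exists>\<theta> \<in> borel_measurable borel. \<forall>x y. (x, y) \<in> E \<longleftrightarrow> (\<theta> x, \<theta> y) \<in> F)"

definition borel_bireducible :: "'p::polish_space rel \<Rightarrow> 'q::polish_space rel \<Rightarrow> bool"
    (infix "\<sim>\<^sub>B" 50) where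
  "E \<sim>\<^sub>B F \<longleftrightarrow> E \<le>\<^sub>B F \<and> F \<le>\<^sub>B E"

lemma equiv_RN_mod:
  assumes zero: "(\<lambda>n. 0) \<in> L"
    and diff: "\<And>a b. a \<in> L \<Longrightarrow> b \<in> L \<Longrightarrow> (\<lambda>n. a n - b n) \<in> L"
  shows "equiv UNIV (RN_mod L)"
proof (rule equivI)
  have neg: "(\<lambda>n. - a n) \<in> L" if "a \<in> L" for a
    using diff[OF zero that] by simp
  show "RN_mod L \<subseteq> UNIV \<times> UNIV" by simp
  show "refl_on UNIV (RN_mod L)"
    using zero by (simp add: refl_on_def RN_mod_def)
  show "sym (RN_mod L)"
    by (rule symI) (use neg in \<open>fastforce simp: RN_mod_def\<close>)
  show "trans (RN_mod L)"
  proof (rule transI)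
    fix x y z assume "(x, y) \<in> RN_mod L" "(y, z) \<in> RN_mod L"
    then have "(\<lambda>n. x n - y n) \<in> L" "(\<lambda>n. - (y n - z n)) \<in> L"
      using neg[of "\<lambda>n. y n - z n"] by (auto simp: RN_mod_def)
    from diff[OF this] show "(x, z) \<in> RN_mod L" by (simp add: RN_mod_def)
  qed
qed

lemma equiv_basis_equiv: "equiv UNIV (basis_equiv x)"
  unfolding basis_equiv_def
  by (rule equiv_RN_mod) (auto simp: coef_def scaleR_diff_left intro: summable_diff)

lemma equiv_RN_mod_c0: "equiv UNIV (RN_mod c0_space)"
  by (rule equiv_RN_mod) (auto simp: c0_space_def dest: tendsto_diff)

lemma equiv_RN_mod_l1: "equiv UNIV (RN_mod l1_space)"
proof (rule equiv_RN_mod)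
  fix a b :: "nat \<Rightarrow> real" assume "a \<in> l1_space" "b \<in> l1_space"
  then have "summable (\<lambda>n. \<bar>a n\<bar> + \<bar>b n\<bar>)"
    by (simp add: l1_space_def summable_add)
  then have "summable (\<lambda>n. \<bar>a n - b n\<bar>)"
    by (rule summable_comparison_test') (use abs_triangle_ineq4 in auto)
  then show "(\<lambda>n. a n - b n) \<in> l1_space" by (simp add: l1_space_def)
qed (simp add: l1_space_def)

end

theory Submission
  imports Defs
begin

text \<open>
  Suppose that \<open>\<theta>\<close> is a Borel reduction of \<open>basis_equiv x\<close> to \<open>RN_mod L\<close>, where \<open>L\<close> is c0 or l1. The
  claim follows once some normalized subsequence \<open>y k = x (N k) / norm (x (N k))\<close> has coefficient
  space exactly \<open>L\<close>, since placing coefficients along it reduces \<open>RN_mod L\<close> to \<open>basis_equiv x\<close>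
  (\<open>RN_mod_reducible_to_basis_equiv\<close>).

  To find the subsequence, restrict \<open>\<theta>\<close> to sequences whose entries come from finer and finer finite
  grids on the lines through the \<open>x i\<close>. A Borel map is continuous on a comeager set. Moreover, a
  change of finitely many entries changes the value of \<open>\<theta>\<close> by an element of \<open>L\<close>, so by the Baire
  category theorem the tail of that change is uniformly small on a large set. A fusion
  (\<open>stage_exists\<close>, \<open>borel_stabilization\<close>) therefore finds free positions \<open>N k\<close>, filler for the other
  positions, and consecutive blocks of coordinates of the values, such that the \<open>k\<close>th block of the
  value depends on the \<open>k\<close>th free entry alone, up to a summable error. The norm of the difference of
  the \<open>k\<close>th blocks is then a pseudometric \<open>D k\<close> on the \<open>k\<close>th grid, and for points \<open>p k\<close>, \<open>q k\<close> of
  the grids the series with coefficients \<open>p k - q k\<close> along \<open>y\<close> converges iff the sequence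
  \<open>D k (p k) (q k)\<close> lies in \<open>L\<close> (\<open>reduction_grid_pseudometrics\<close>).

  The convergence of the series depends on the differences \<open>p k - q k\<close> only. For c0 this, with
  absolutely convergent series as test cases, forces \<open>D k (p k) (q k)\<close> to tend to 0 whenever
  \<open>p k - q k\<close> does, so all null sequences are coefficient
  sequences (\<open>equivalent_to_c0\<close>). For l1, \<open>D k\<close> separates 0 from the upper half of the unit interval
  by a fixed amount, for large \<open>k\<close>. When the interval is divided into steps of length \<open>\<bar>a k\<bar>\<close>,
  the triangle inequality yields a step whose \<open>D k\<close>-length is at least a constant times \<open>\<bar>a k\<bar>\<close>. Hence
  convergence of the series with coefficients \<open>a\<close> implies that \<open>a\<close> is in l1 (\<open>equivalent_to_l1\<close>). The remaining inclusions hold for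
  every sequence of unit vectors.
\<close>

section \<open>Baire category\<close>

definition meager :: "'a::topological_space set \<Rightarrow> bool" where
  "meager S \<longleftrightarrow> (\<exists>T::nat \<Rightarrow> 'a set. (\<forall>n. closed (T n) \<and> interior (T n) = {}) \<and> S \<subseteq> (\<Union>n. T n))"

lemma meagerE:
  fixes S :: "'a::topological_space set"
  assumes "meager S"
  obtains T :: "nat \<Rightarrow> 'a set"
    where "\<forall>n. closed (T n) \<and> interior (T n) = {}" "S \<subseteq> (\<Union>n. T n)"
  using assms unfolding meager_def by blast

lemma meager_subset: "meager T \<Longrightarrow> S \<subseteq> T \<Longrightarrow> meager S"
  unfolding meager_def by (meson order_trans)

lemma meager_nowhere_dense:
  assumes "closed S" "interior S = {}"
  shows "meager S"
  unfolding meager_def using assms by (intro exI[of _ "\<lambda>_. S"]) auto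

lemma meager_UN_nat:
  fixes S :: "nat \<Rightarrow> 'a::topological_space set"
  assumes "\<And>n. meager (S n)"
  shows "meager (\<Union>n. S n)"
proof -
  obtain T :: "nat \<Rightarrow> nat \<Rightarrow> 'a set" where
    T: "\<And>n k. closed (T n k) \<and> interior (T n k) = {}" "\<And>n. S n \<subseteq> (\<Union>k. T n k)"
    using assms unfolding meager_def by metis
  define T' where "T' = (\<lambda>m. case prod_decode m of (n, k) \<Rightarrow> T n k)"
  have "(\<Union>n. S n) \<subseteq> (\<Union>m. T' m)"
  proof
    fix z assume "z \<in> (\<Union>n. S n)"
    then obtain n k where "z \<in> T n k" using T(2) by blast
    then have "z \<in> T' (prod_encode (n, k))" by (simp add: T'_def)
    then show "z \<in> (\<Union>m. T' m)" by blast
  qed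
  then show ?thesis
    unfolding meager_def using T(1) by (intro exI[of _ T']) (auto simp: T'_def split: prod.split)
qed

lemma meager_UN:
  assumes "countable I" "\<And>i. i \<in> I \<Longrightarrow> meager (S i)"
  shows "meager (\<Union>i\<in>I. S i)"
proof (cases "I = {}")
  case True
  then show ?thesis by (simp add: meager_nowhere_dense)
next
  case False
  then have "(\<Union>i\<in>I. S i) = (\<Union>n. S (from_nat_into I n))"
    using assms(1) range_from_nat_into[of I] by (simp flip: image_image)
  then show ?thesis
    using assms(2) False by (simp add: meager_UN_nat from_nat_into)
qed

lemma meager_Un:
  assumes "meager S" "meager T"
  shows "meager (S \<union> T)"
  using meager_UN[of "{S, T}" "\<lambda>S. S"] assms by auto

definition baire_property :: "'a::topological_space set \<Rightarrow> bool" where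
  "baire_property S \<longleftrightarrow> (\<exists>U. open U \<and> meager (sym_diff S U))"

text \<open>The frontier of an open set is nowhere dense. This is what lets the Baire property pass to
  complements: the interior of the complement differs from the complement only on the frontier.\<close>

lemma interior_open_frontier:
  assumes "open U"
  shows "interior (frontier U) = {}"
proof -
  have "U \<inter> interior (frontier U) = {}"
    using assms interior_subset[of "frontier U"] by (auto simp: frontier_def interior_open)
  then have "closure U \<inter> interior (frontier U) = {}"
    using open_Int_closure_eq_empty[OF open_interior, of "frontier U" U] by (simp add: inf_commute)
  then show ?thesis
    using interior_subset[of "frontier U"] by (auto simp: frontier_def)
qed

lemma baire_property_borel:
  assumes "S \<in> sets borel"
  shows "baire_property S"
  using assms unfolding sets_borel
proof (induction rule: sigma_sets.induct)
  case (Basic S)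
  then show ?case
    unfolding baire_property_def by (intro exI[of _ S]) (auto intro: meager_nowhere_dense)
next
  case Empty
  show ?case
    unfolding baire_property_def by (intro exI[of _ "{}"]) (auto intro: meager_nowhere_dense)
next
  case (Compl S)
  then obtain U where U: "open U" "meager (sym_diff S U)"
    unfolding baire_property_def by auto
  have "meager (frontier U)"
    using U(1) by (intro meager_nowhere_dense interior_open_frontier) simp_all
  then have "meager (sym_diff S U \<union> frontier U)"
    using U(2) by (rule meager_Un[rotated])
  moreover have "sym_diff (UNIV - S) (- closure U) \<subseteq> sym_diff S U \<union> frontier U"
    unfolding frontier_def interior_open[OF U(1)] using closure_subset[of U] by blast
  ultimately have "meager (sym_diff (UNIV - S) (- closure U))"
    by (rule meager_subset)
  then show ?case
    unfolding baire_property_def by (intro exI[of _ "- closure U"]) (simp add: open_Compl)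
next
  case (Union S)
  then have "\<forall>i. \<exists>U. open U \<and> meager (sym_diff (S i) U)"
    unfolding baire_property_def by blast
  from choice[OF this] obtain U where
    U: "\<And>i. open (U i)" "\<And>i. meager (sym_diff (S i) (U i))"
    by blast
  have "meager (\<Union>i. sym_diff (S i) (U i))"
    using U(2) by (rule meager_UN_nat)
  then have "meager (sym_diff (\<Union>i. S i) (\<Union>i. U i))"
    by (rule meager_subset) auto
  then show ?case
    unfolding baire_property_def using U(1) by blast
qed

text \<open>Over a countable base of the codomain, each preimage agrees with an open set off a meager set.
  Off the union of these countably many exceptional sets all preimages of open sets are relatively
  open. The exceptional set comes out as a countable union of closed nowhere dense sets, whose
  complements are dense open conditions that a fusion can meet one at a time.\<close>

lemma borel_measurable_continuous_comeager:
  fixes f :: "'a::topological_space \<Rightarrow> 'b::second_countable_topology"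
  assumes "f \<in> borel_measurable borel"
  obtains T :: "nat \<Rightarrow> 'a set" where "\<And>n. closed (T n)" "\<And>n. interior (T n) = {}"
    "continuous_on (- (\<Union>n. T n)) f"
proof -
  obtain B :: "'b set set" where B: "countable B" "topological_basis B"
    using ex_countable_basis by blast
  have "baire_property (f -` b)" if "b \<in> B" for b
    using measurable_sets[OF assms, of b] topological_basis_open[OF B(2) that]
    by (intro baire_property_borel) simp
  then obtain U where U: "\<And>b. b \<in> B \<Longrightarrow> open (U b)"
     "\<And>b. b \<in> B \<Longrightarrow> meager (sym_diff (f -` b) (U b))"
    unfolding baire_property_def by metis
  have "meager (\<Union>b\<in>B. sym_diff (f -` b) (U b))"
    using B(1) U(2) by (rule meager_UN)
  then obtain T :: "nat \<Rightarrow> 'a set" where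
    T: "\<forall>n. closed (T n) \<and> interior (T n) = {}"
       "(\<Union>b\<in>B. sym_diff (f -` b) (U b)) \<subseteq> (\<Union>n. T n)"
    by (rule meagerE)
  define G where "G = - (\<Union>n. T n)"
  have "continuous_on G f"
    unfolding continuous_on_open_invariant
  proof (intro allI impI)
    fix V :: "'b set" assume "open V"
    then obtain B' where B': "B' \<subseteq> B" "\<Union>B' = V"
      using B(2) unfolding topological_basis_def by metis
    have "z \<in> U b \<longleftrightarrow> f z \<in> b" if "b \<in> B" "z \<in> G" for b z
    proof -
      have "z \<notin> sym_diff (f -` b) (U b)"
        using T(2) that unfolding G_def by blast
      then show ?thesis by blast
    qed
    then have "(\<Union>b\<in>B'. U b) \<inter> G = f -` V \<inter> G"
      using B' by fast
    moreover have "open (\<Union>b\<in>B'. U b)"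
      using U(1) B'(1) by blast
    ultimately show "\<exists>A. open A \<and> A \<inter> G = f -` V \<inter> G" by blast
  qed
  then show ?thesis using that[of T] T(1) unfolding G_def by blast
qed

section \<open>The Baire space of sequences of natural numbers\<close>

lemma Baire_category_nat_nat:
  fixes S :: "(nat \<Rightarrow> nat) set"
  assumes "meager S"
  shows "interior S = {}"
proof -
  obtain T :: "nat \<Rightarrow> (nat \<Rightarrow> nat) set" where
    T: "\<And>n. closed (T n)" "\<And>n. interior (T n) = {}" "S \<subseteq> (\<Union>n. T n)"
    using assms unfolding meager_def by blast
  have "(euclidean :: nat topology) = discrete_topology UNIV"
    by (simp add: topology_eq flip: open_openin) (simp add: open_discrete)
  then have "completely_metrizable_space (euclidean :: (nat \<Rightarrow> nat) topology)"
    by (simp add: completely_metrizable_space_product_topology 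
        completely_metrizable_space_discrete_topology flip: euclidean_product_topology)
  then have "euclidean interior_of (\<Union>(range T)) = {}"
    by (intro Baire_category_alt) (use T in auto)
  then show ?thesis
    using interior_mono[OF T(3)] by simp
qed

lemma open_cylinder: "open {y::nat \<Rightarrow> nat. \<forall>i<n. y i = z i}"
  using product_topology_basis'[of "{..<n}" "\<lambda>i. {z i}" "\<lambda>i. i"]
  by (simp add: open_discrete lessThan_def Ball_def)

lemma open_contains_cylinder:
  fixes U :: "(nat \<Rightarrow> nat) set"
  assumes "open U" "z \<in> U"
  obtains n where "\<And>y. (\<And>i. i < n \<Longrightarrow> y i = z i) \<Longrightarrow> y \<in> U"
proof -
  have "openin (product_topology (\<lambda>_. euclidean) UNIV) U"
    using assms(1) by (simp add: euclidean_product_topology)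
  from product_topology_open_contains_basis[OF this assms(2)]
  obtain X where X: "z \<in> Pi\<^sub>E UNIV X" "finite {i. X i \<noteq> UNIV}" "Pi\<^sub>E UNIV X \<subseteq> U"
    by auto
  obtain n where n: "\<And>i. X i \<noteq> UNIV \<Longrightarrow> i < n"
    using X(2) by (auto simp: finite_nat_set_iff_bounded)
  show ?thesis
  proof (rule that)
    fix y assume y: "\<And>i. i < n \<Longrightarrow> y i = z i"
    have "y i \<in> X i" for i
      using X(1) n[of i] y[of i] by (cases "X i = UNIV") (auto simp: PiE_iff)
    then show "y \<in> U" using X(3) by (auto simp: PiE_iff)
  qed
qed

definition splice :: "nat \<Rightarrow> (nat \<Rightarrow> nat) \<Rightarrow> (nat \<Rightarrow> nat) \<Rightarrow> nat \<Rightarrow> nat" where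
  "splice j r z = (\<lambda>i. if i < j then r i else z i)"

lemma continuous_splice: "continuous_on UNIV (splice j r)"
proof (rule continuous_on_coordinatewise_then_product)
  show "continuous_on UNIV (\<lambda>z. splice j r z i)" for i
    by (cases "i < j") (simp_all add: splice_def)
qed

text \<open>Overwriting the first \<open>j\<close> entries maps cylinders that fix at least \<open>j\<close> entries onto cylinders,
  so it pulls nowhere dense sets back to nowhere dense sets. Hence a generic sequence stays generic
  after any of finitely many changes of its initial segment.\<close>

lemma meager_splice_vimage:
  assumes "closed T" "interior T = {}"
  shows "meager (splice j r -` T)"
proof (rule meager_nowhere_dense)
  show "closed (splice j r -` T)"
    using assms(1) continuous_splice by (rule closed_vimage)
  show "interior (splice j r -` T) = {}"
  proof (rule ccontr)
    assume "interior (splice j r -` T) \<noteq> {}"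
    then obtain z where "z \<in> interior (splice j r -` T)" by blast
    then obtain n where n: "\<And>y. (\<And>i. i < n \<Longrightarrow> y i = z i) \<Longrightarrow> y \<in> interior (splice j r -` T)"
      by (rule open_contains_cylinder[OF open_interior]) blast
    have "{y. \<forall>i<max j n. y i = splice j r z i} \<subseteq> T"
    proof safe
      fix y assume y: "\<forall>i<max j n. y i = splice j r z i"
      have "splice j z y \<in> interior (splice j r -` T)"
        by (rule n) (use y in \<open>auto simp: splice_def\<close>)
      then have "splice j z y \<in> splice j r -` T"
        using interior_subset by blast
      moreover have "splice j r (splice j z y) = y"
        using y by (auto simp: splice_def)
      ultimately show "y \<in> T" by simp
    qed
    then have "splice j r z \<in> interior T"
      by (intro interiorI[OF open_cylinder]) auto
    then show False using assms(2) by simp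
  qed
qed

section \<open>Stabilizing a Borel map on a subproduct\<close>

text \<open>A uniform form of the Cauchy condition on tails. When \<open>F\<close> consists of all finite sets it is
  absolute convergence of the series of \<open>v\<close>; when \<open>F\<close> consists of the sets with at most one element
  it is convergence of \<open>v\<close> to 0. One stabilization argument then serves both spaces.\<close>

definition tail_small :: "nat set set \<Rightarrow> (nat \<Rightarrow> real) set" where
  "tail_small F = {v. \<forall>\<epsilon>>0. \<exists>l. \<forall>S\<in>F. S \<subseteq> {l..} \<longrightarrow> (\<Sum>i\<in>S. \<bar>v i\<bar>) \<le> \<epsilon>}"

lemma splice_splice: "splice j r (splice j h z) = splice j r z"
  by (auto simp: splice_def)

lemma splice_restrict: "(\<And>i. i < j \<Longrightarrow> y i = z i) \<Longrightarrow> splice j (restrict y {..<j}) z = z"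
  by (auto simp: splice_def)

definition agree :: "nat set \<Rightarrow> (nat \<Rightarrow> nat) \<Rightarrow> (nat \<Rightarrow> nat) \<Rightarrow> bool" where
  "agree A z z' \<longleftrightarrow> (\<forall>i\<in>A. z i = z' i)"

text \<open>The initial segment of length \<open>j\<close> is bounded by \<open>m\<close>, and replacing it by any other segment with
  this bound leaves the sequence in \<open>G\<close>. The bound makes the number of replacements finite.\<close>

definition robust :: "nat \<Rightarrow> nat \<Rightarrow> (nat \<Rightarrow> nat) set \<Rightarrow> (nat \<Rightarrow> nat) \<Rightarrow> bool" where
  "robust j m G z \<longleftrightarrow> (\<forall>i<j. z i \<le> m) \<and> (\<forall>r. (\<forall>i<j. r i \<le> m) \<longrightarrow> splice j r z \<in> G)"

text \<open>What one step of the fusion achieves by prescribing the entries from \<open>j\<close> to \<open>N\<close> to be those of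
  \<open>h\<close>, whatever the entries before \<open>j\<close> are (up to the bound \<open>m\<close>). The three clauses say: the
  exceptional sets up to \<open>k\<close> are avoided; for robust sequences, the coordinates of \<open>f z\<close> from \<open>l\<close>
  on hardly depend on the entries of \<open>z\<close> before \<open>j\<close>; for robust sequences, the coordinates of \<open>f z\<close> before \<open>l\<close> hardly depend on the entries of
  \<open>z\<close> from \<open>N\<close> on.\<close>

definition stage :: "(nat \<Rightarrow> (nat \<Rightarrow> nat) set) \<Rightarrow> ((nat \<Rightarrow> nat) \<Rightarrow> nat \<Rightarrow> real) \<Rightarrow> nat set set \<Rightarrow>
    real \<Rightarrow> nat \<Rightarrow> nat \<Rightarrow> nat \<Rightarrow> nat \<Rightarrow> (nat \<Rightarrow> nat) \<Rightarrow> nat \<Rightarrow> bool" where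
  "stage T f F \<epsilon> k m j N h l \<longleftrightarrow>
    (\<forall>z. (\<forall>i<j. z i \<le> m) \<longrightarrow> agree {j..<N} z h \<longrightarrow> (\<forall>n\<le>k. z \<notin> T n)) \<and>
    (\<forall>z z'. robust j m (- (\<Union>n. T n)) z \<longrightarrow> robust j m (- (\<Union>n. T n)) z' \<longrightarrow>
       agree {j..<N} z h \<longrightarrow> agree {j..} z z' \<longrightarrow>
       (\<forall>S\<in>F. S \<subseteq> {l..} \<longrightarrow> (\<Sum>i\<in>S. \<bar>f z i - f z' i\<bar>) \<le> \<epsilon>)) \<and>
    (\<forall>z z'. robust j m (- (\<Union>n. T n)) z \<longrightarrow> robust j m (- (\<Union>n. T n)) z' \<longrightarrow>
       agree {j..<N} z h \<longrightarrow> agree {..<N} z z' \<longrightarrow> (\<Sum>i<l. \<bar>f z i - f z' i\<bar>) \<le> \<epsilon>)"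

lemma stage_cong:
  assumes "\<And>i. j \<le> i \<Longrightarrow> h i = h' i"
  shows "stage T f F \<epsilon> k m j N h l = stage T f F \<epsilon> k m j N h' l"
proof -
  have "agree {j..<N} z h \<longleftrightarrow> agree {j..<N} z h'" for z
    using assms by (simp add: agree_def)
  then show ?thesis by (simp add: stage_def)
qed

text \<open>Sequences that differ in finitely many places have images with small tails, so the
  following sets \<open>E l\<close> cover the space: \<open>z\<close> is in \<open>E l\<close> if any two replacements of its initial
  segment within the bound \<open>m\<close> have images that differ from \<open>l\<close> on by at most \<open>\<epsilon>\<close>. These sets are
  relatively closed in the comeager set \<open>H\<close> on which everything is continuous. By the Baire
  category theorem one of them contains a relatively open piece of \<open>H\<close>, which gives the second
  clause of a stage. Continuity at a point \<open>h\<close> of this piece gives the third, and openness of the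
  complements of the exceptional sets gives the first, all on one cylinder around \<open>h\<close>.\<close>

lemma stage_exists:
  fixes f :: "(nat \<Rightarrow> nat) \<Rightarrow> nat \<Rightarrow> real"
  assumes T: "\<And>n::nat. closed (T n)" "\<And>n. interior (T n) = {}"
    and cont: "continuous_on (- (\<Union>n. T n)) f"
    and fin: "\<And>S. S \<in> F \<Longrightarrow> finite S"
    and tail: "\<And>z z' j. \<forall>i\<ge>j. z i = z' i \<Longrightarrow> (\<lambda>i. f z i - f z' i) \<in> tail_small F"
    and \<epsilon>: "\<epsilon> > 0"
  shows "\<exists>N' l' h. j \<le> N' \<and> l < l' \<and> stage T f F \<epsilon> k m j N' h l'"
proof -
  define G where "G = - (\<Union>n. T n)"
  have cont: "continuous_on G f" using cont by (simp add: G_def)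
  define R where "R = PiE {..<j} (\<lambda>_. {..m})"
  have finR: "finite R" unfolding R_def by (intro finite_PiE) auto
  have R_ne: "R \<noteq> {}" unfolding R_def by (simp add: PiE_eq_empty_iff)
  define H where "H = {z. \<forall>r\<in>R. splice j r z \<in> G}"
  have "meager (\<Union>r\<in>R. \<Union>n. splice j r -` T n)"
    using finR T by (intro meager_UN meager_UN_nat meager_splice_vimage) (auto simp: countable_finite)
  moreover have "- H = (\<Union>r\<in>R. \<Union>n. splice j r -` T n)"
    by (auto simp: H_def G_def)
  ultimately have H: "meager (- H)" by simp
  have contH: "continuous_on H (\<lambda>z. f (splice j r z) i)" if "r \<in> R" for r i
  proof -
    have "continuous_on (splice j r ` H) f"
      by (rule continuous_on_subset[OF cont]) (use that in \<open>auto simp: H_def\<close>)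
    then have "continuous_on H (\<lambda>z. f (splice j r z))"
      using continuous_on_subset[OF continuous_splice] continuous_on_compose2 by blast
    then show ?thesis by (rule continuous_on_product_then_coordinatewise)
  qed
  define E where "E = (\<lambda>l. {z. \<forall>r\<in>R. \<forall>r'\<in>R. \<forall>S\<in>F. S \<subseteq> {l..} \<longrightarrow>
     (\<Sum>i\<in>S. \<bar>f (splice j r z) i - f (splice j r' z) i\<bar>) \<le> \<epsilon>})"
  have E_mono: "E l \<subseteq> E l'" if "l \<le> l'" for l l'
  proof -
    have "{l'..} \<subseteq> {l..}" using that by auto
    then show ?thesis unfolding E_def by (blast intro: subset_trans)
  qed
  have E_cover: "\<exists>l. z \<in> E l" for z
  proof -
    have ev: "\<forall>\<^sub>F l in sequentially. \<forall>S\<in>F. S \<subseteq> {l..} \<longrightarrow>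
       (\<Sum>i\<in>S. \<bar>f (splice j r z) i - f (splice j r' z) i\<bar>) \<le> \<epsilon>" for r r'
    proof -
      have "(\<lambda>i. f (splice j r z) i - f (splice j r' z) i) \<in> tail_small F"
        by (rule tail[of j]) (simp add: splice_def)
      then obtain l where l: "\<forall>S\<in>F. S \<subseteq> {l..} \<longrightarrow>
         (\<Sum>i\<in>S. \<bar>f (splice j r z) i - f (splice j r' z) i\<bar>) \<le> \<epsilon>"
        using \<epsilon> unfolding tail_small_def by blast
      show ?thesis
        unfolding eventually_sequentially
      proof (intro exI[of _ l] allI impI ballI)
        fix l' S assume "l \<le> l'" "S \<in> F" "S \<subseteq> {l'..}"
        then have "S \<subseteq> {l..}" by auto
        then show "(\<Sum>i\<in>S. \<bar>f (splice j r z) i - f (splice j r' z) i\<bar>) \<le> \<epsilon>"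
          using l \<open>S \<in> F\<close> by blast
      qed
    qed
    have "\<forall>\<^sub>F l in sequentially. \<forall>r\<in>R. \<forall>r'\<in>R. \<forall>S\<in>F. S \<subseteq> {l..} \<longrightarrow>
       (\<Sum>i\<in>S. \<bar>f (splice j r z) i - f (splice j r' z) i\<bar>) \<le> \<epsilon>"
      by (intro eventually_ball_finite finR ballI ev)
    then have "\<forall>\<^sub>F l in sequentially. z \<in> E l" by (simp add: E_def)
    then show ?thesis by (meson eventually_happens trivial_limit_sequentially)
  qed
  have E_closed: "closure (E l \<inter> H) \<inter> H \<subseteq> E l" for l
  proof
    fix z assume z: "z \<in> closure (E l \<inter> H) \<inter> H"
    show "z \<in> E l"
      unfolding E_def
    proof (intro CollectI ballI impI)
      fix r r' S assume r: "r \<in> R" "r' \<in> R" and S: "S \<in> F" "S \<subseteq> {l..}"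
      let ?g = "\<lambda>z. \<Sum>i\<in>S. \<bar>f (splice j r z) i - f (splice j r' z) i\<bar>"
      have "continuous_on H ?g"
        using contH r by (intro continuous_intros) auto
      then have "closedin (top_of_set H) (H \<inter> ?g -` {..\<epsilon>})"
        by (rule continuous_closedin_preimage) simp
      then obtain K where K: "closed K" "H \<inter> ?g -` {..\<epsilon>} = H \<inter> K"
        by (auto simp: closedin_closed)
      have "E l \<inter> H \<subseteq> H \<inter> ?g -` {..\<epsilon>}"
        using r S by (auto simp: E_def)
      then have "closure (E l \<inter> H) \<subseteq> K"
        using K by (intro closure_minimal) auto
      then have "z \<in> H \<inter> ?g -` {..\<epsilon>}" using z K(2) by blast
      then show "?g z \<le> \<epsilon>" by simp
    qed
  qed
  have "\<exists>l. interior (closure (E l \<inter> H)) \<noteq> {}"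
  proof (rule ccontr)
    assume "\<not> ?thesis"
    then have "meager (closure (E l \<inter> H))" for l
      by (intro meager_nowhere_dense) auto
    then have "meager (- H \<union> (\<Union>l. closure (E l \<inter> H)))"
      using H by (intro meager_Un meager_UN_nat)
    moreover have "z \<in> - H \<union> (\<Union>l. closure (E l \<inter> H))" for z
      using E_cover[of z] closure_subset[of "E _ \<inter> H"] by auto
    then have "UNIV \<subseteq> - H \<union> (\<Union>l. closure (E l \<inter> H))" by blast
    ultimately have "meager (UNIV :: (nat \<Rightarrow> nat) set)"
      by (rule meager_subset)
    then show False using Baire_category_nat_nat[of UNIV] by simp
  qed
  then obtain l0 where l0: "interior (closure (E l0 \<inter> H)) \<noteq> {}" by blast
  define U where "U = interior (closure (E l0 \<inter> H))"
  have U: "open U" "U \<noteq> {}" using l0 by (simp_all add: U_def)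
  define l' where "l' = max l0 (Suc l)"
  have UE: "U \<inter> H \<subseteq> E l'"
  proof -
    have "U \<inter> H \<subseteq> closure (E l0 \<inter> H) \<inter> H"
      unfolding U_def by (intro Int_mono interior_subset order_refl)
    also have "\<dots> \<subseteq> E l0" by (rule E_closed)
    also have "\<dots> \<subseteq> E l'" by (rule E_mono) (simp add: l'_def)
    finally show ?thesis .
  qed
  have "\<not> U \<subseteq> - H"
  proof
    assume "U \<subseteq> - H"
    then have "U \<subseteq> interior (- H)" using U(1) by (rule interior_maximal)
    then show False using Baire_category_nat_nat[OF H] U(2) by simp
  qed
  then obtain h where h: "h \<in> U" "h \<in> H" by blast
  have "\<exists>V. open V \<and> h \<in> V \<and> (\<forall>y\<in>V \<inter> H. (\<Sum>i<l'. \<bar>f (splice j r y) i - f (splice j r h) i\<bar>) < \<epsilon> / 2)"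
    if "r \<in> R" for r
  proof -
    let ?g = "\<lambda>z. \<Sum>i<l'. \<bar>f (splice j r z) i - f (splice j r h) i\<bar>"
    have "continuous_on H ?g"
      using contH[OF that] by (intro continuous_intros) auto
    then have "openin (top_of_set H) (H \<inter> ?g -` {..<\<epsilon>/2})"
      by (rule continuous_openin_preimage_gen) simp
    then obtain V where V: "open V" "H \<inter> ?g -` {..<\<epsilon>/2} = H \<inter> V"
      by (auto simp: openin_open)
    have "h \<in> V" using V(2) h(2) \<epsilon> by auto
    moreover have "\<forall>y\<in>V \<inter> H. ?g y < \<epsilon>/2" using V(2) by blast
    ultimately show ?thesis using V(1) by blast
  qed
  then obtain V where V: "\<And>r. r \<in> R \<Longrightarrow> open (V r)" "\<And>r. r \<in> R \<Longrightarrow> h \<in> V r"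
    "\<And>r y. r \<in> R \<Longrightarrow> y \<in> V r \<Longrightarrow> y \<in> H \<Longrightarrow>
       (\<Sum>i<l'. \<bar>f (splice j r y) i - f (splice j r h) i\<bar>) < \<epsilon> / 2"
    by (metis IntI)
  define W where "W = U \<inter> (\<Inter>r\<in>R. V r) \<inter> (\<Inter>r\<in>R. \<Inter>n\<le>k. splice j r -` (- T n))"
  have "open (splice j r -` (- T n))" for r n
    using T(1) continuous_splice by (intro open_vimage) auto
  then have "open W"
    unfolding W_def using U(1) V(1) finR by (intro open_Int open_INT ballI) auto
  moreover have "h \<in> W"
    using h V(2) by (auto simp: W_def H_def G_def)
  ultimately obtain n where n: "\<And>y. (\<And>i. i < n \<Longrightarrow> y i = h i) \<Longrightarrow> y \<in> W"
    by (rule open_contains_cylinder) blast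
  define N' where "N' = max j n"
  \<comment> \<open>A cylinder around \<open>h\<close> also fixes the entries before \<open>j\<close>. This costs nothing, since every
    condition above is about \<open>splice j r z\<close>, which forgets those entries of \<open>z\<close>.\<close>
  have in_W: "splice j h z \<in> W" if "agree {j..<N'} z h" for z
    by (rule n) (use that in \<open>auto simp: splice_def N'_def agree_def\<close>)
  have in_H: "splice j h z \<in> H" if "robust j m G z" for z
    using that by (auto simp: H_def splice_splice robust_def R_def PiE_iff)
  have in_R: "restrict z {..<j} \<in> R" if "\<forall>i<j. z i \<le> m" for z
    using that by (auto simp: R_def)
  have "stage T f F \<epsilon> k m j N' h l'"
    unfolding stage_def G_def[symmetric]
  proof (intro conjI allI impI ballI)
    fix z n assume *: "\<forall>i<j. z i \<le> m" "agree {j..<N'} z h" "n \<le> k"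
    have "splice j h z \<in> splice j (restrict z {..<j}) -` (- T n)"
      using in_W[OF *(2)] in_R[OF *(1)] *(3) unfolding W_def by blast
    then show "z \<notin> T n" by (simp add: splice_splice splice_restrict)
  next
    fix z z' S
    assume *: "robust j m G z" "robust j m G z'" "agree {j..<N'} z h" "agree {j..} z z'"
      and S: "S \<in> F" "S \<subseteq> {l'..}"
    have R: "restrict z {..<j} \<in> R" "restrict z' {..<j} \<in> R"
      using * by (auto simp: robust_def intro!: in_R)
    have "splice j h z \<in> U \<inter> H"
      using in_W[OF *(3)] in_H[OF *(1)] by (simp add: W_def)
    then have "splice j h z \<in> E l'" using UE by blast
    then have "(\<Sum>i\<in>S. \<bar>f (splice j (restrict z {..<j}) (splice j h z)) i
       - f (splice j (restrict z' {..<j}) (splice j h z)) i\<bar>) \<le> \<epsilon>"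
      using R S unfolding E_def by blast
    moreover have "splice j (restrict z' {..<j}) z = z'"
      using *(4) by (auto simp: splice_def agree_def)
    ultimately show "(\<Sum>i\<in>S. \<bar>f z i - f z' i\<bar>) \<le> \<epsilon>"
      by (simp add: splice_splice splice_restrict)
  next
    fix z z'
    assume *: "robust j m G z" "robust j m G z'" "agree {j..<N'} z h" "agree {..<N'} z z'"
    define r where "r = restrict z {..<j}"
    have r: "r \<in> R" using *(1) by (auto simp: r_def robust_def intro!: in_R)
    have z: "splice j r (splice j h z) = z"
      by (simp add: r_def splice_splice splice_restrict)
    have z': "splice j r (splice j h z') = z'"
      using *(4) by (simp add: r_def splice_splice splice_restrict N'_def agree_def)
    have "agree {j..<N'} z' h"
      using *(3,4) by (auto simp: agree_def)
    then have "splice j h z' \<in> V r" "splice j h z \<in> V r"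
      using in_W *(3) r unfolding W_def by blast+
    then have "(\<Sum>i<l'. \<bar>f z' i - f (splice j r h) i\<bar>) < \<epsilon> / 2"
      "(\<Sum>i<l'. \<bar>f z i - f (splice j r h) i\<bar>) < \<epsilon> / 2"
      using V(3)[OF r _ in_H[OF *(1)]] V(3)[OF r _ in_H[OF *(2)]] by (simp_all add: z z')
    moreover have "(\<Sum>i<l'. \<bar>f z i - f z' i\<bar>)
       \<le> (\<Sum>i<l'. \<bar>f z i - f (splice j r h) i\<bar> + \<bar>f z' i - f (splice j r h) i\<bar>)"
      by (intro sum_mono) linarith
    ultimately show "(\<Sum>i<l'. \<bar>f z i - f z' i\<bar>) \<le> \<epsilon>"
      by (simp add: sum.distrib)
  qed
  moreover have "j \<le> N'" "l < l'" by (simp_all add: N'_def l'_def)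
  ultimately show ?thesis by blast
qed

text \<open>The sequence with \<open>a k\<close> in position \<open>N k\<close> and the fixed filler \<open>w\<close> elsewhere; \<open>N\<close> is meant to
  be injective.\<close>

definition place :: "(nat \<Rightarrow> nat) \<Rightarrow> (nat \<Rightarrow> nat) \<Rightarrow> (nat \<Rightarrow> nat) \<Rightarrow> nat \<Rightarrow> nat" where
  "place N w a = (\<lambda>i. if i \<in> range N then a (inv N i) else w i)"

text \<open>A fusion alternates one free position \<open>N k\<close> with a word of the filler \<open>w\<close> chosen by
  \<open>stage_exists\<close>. On the resulting product of finite sets, the block of \<open>f\<close> between \<open>l k\<close> and
  \<open>l (Suc k)\<close> is determined up to \<open>2 * (1 / 2) ^ k\<close> by the single entry \<open>a k\<close>: the word after
  position \<open>N (k - 1)\<close> removes the influence of the earlier entries, and the word after position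
  \<open>N k\<close> that of the later ones.\<close>

theorem borel_stabilization:
  fixes f :: "(nat \<Rightarrow> nat) \<Rightarrow> nat \<Rightarrow> real" and b :: "nat \<Rightarrow> nat"
  assumes f: "f \<in> borel_measurable borel"
    and fin: "\<And>S. S \<in> F \<Longrightarrow> finite S"
    and tail: "\<And>z z' j. \<forall>i\<ge>j. z i = z' i \<Longrightarrow> (\<lambda>i. f z i - f z' i) \<in> tail_small F"
  obtains N l w where "strict_mono N" "strict_mono l"
    "\<And>a a' k S. (\<And>i. a i \<le> b (N i)) \<Longrightarrow> (\<And>i. a' i \<le> b (N i)) \<Longrightarrow> a k = a' k \<Longrightarrow>
       S \<in> F \<Longrightarrow> S \<subseteq> {l k..<l (Suc k)} \<Longrightarrow>
       (\<Sum>i\<in>S. \<bar>f (place N w a) i - f (place N w a') i\<bar>) \<le> 2 * (1 / 2) ^ k"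
proof -
  obtain T :: "nat \<Rightarrow> (nat \<Rightarrow> nat) set" where
    T: "\<And>n. closed (T n)" "\<And>n. interior (T n) = {}" and cont: "continuous_on (- (\<Union>n. T n)) f"
    using borel_measurable_continuous_comeager[OF f] by blast
  define G where "G = - (\<Union>n. T n)"
  define \<epsilon> where "\<epsilon> = (\<lambda>k. (1 / 2 :: real) ^ Suc k)"
  \<comment> \<open>State of the fusion: the next free position \<open>N\<close>, the block boundary \<open>l\<close>, a bound \<open>m\<close> for all
    entries up to and including position \<open>N\<close>, and a sequence \<open>h\<close> holding the filler found so far.\<close>
  define P where "P = (\<lambda>(N, l::nat, m, h::nat \<Rightarrow> nat). b N \<le> m \<and> (\<forall>i<N. h i \<le> m))"
  define Q where "Q = (\<lambda>k (N, l, m, h) (N', l', m', h').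
     N < N' \<and> l < l' \<and> m \<le> m' \<and> (\<forall>i\<le>N. h' i = h i) \<and> stage T f F (\<epsilon> k) k m (Suc N) N' h' l')"
  have step: "\<exists>s'. P s' \<and> Q k s s'" if "P s" for s k
  proof -
    obtain N l m h where s: "s = (N, l, m, h)" by (cases s) auto
    have "\<epsilon> k > 0" by (simp add: \<epsilon>_def)
    have "\<exists>N' l' h. Suc N \<le> N' \<and> l < l' \<and> stage T f F (\<epsilon> k) k m (Suc N) N' h l'"
      by (rule stage_exists[OF T cont fin tail \<open>\<epsilon> k > 0\<close>])
    then obtain N' l' h0 where st: "Suc N \<le> N'" "l < l'" "stage T f F (\<epsilon> k) k m (Suc N) N' h0 l'"
      by blast
    define h' where "h' = splice (Suc N) h h0"
    define m' where "m' = m + b N' + (\<Sum>i<N'. h' i)"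
    have "h' i \<le> m'" if "i < N'" for i
      using member_le_sum[of i "{..<N'}" h'] that by (simp add: m'_def)
    then have "P (N', l', m', h')" by (simp add: P_def m'_def)
    moreover have "stage T f F (\<epsilon> k) k m (Suc N) N' h' l'"
      using st(3) by (subst stage_cong[where h' = h0]) (auto simp: h'_def splice_def)
    then have "Q k s (N', l', m', h')"
      using st(1,2) by (simp add: Q_def s m'_def h'_def splice_def)
    ultimately show ?thesis by blast
  qed
  have init: "P (0, 0, b 0, \<lambda>_. 0)" by (simp add: P_def)
  obtain s where s: "\<And>k. P (s k)" "\<And>k. Q k (s k) (s (Suc k))"
    using dependent_nat_choice[of "\<lambda>_. P" Q] init step by blast
  define N where "N = (\<lambda>k. fst (s k))"
  define l where "l = (\<lambda>k. fst (snd (s k)))"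
  define m where "m = (\<lambda>k. fst (snd (snd (s k))))"
  define h where "h = (\<lambda>k. snd (snd (snd (s k))))"
  have s_eq: "s k = (N k, l k, m k, h k)" for k
    by (simp add: N_def l_def m_def h_def)
  have Pk: "b (N k) \<le> m k" "\<And>i. i < N k \<Longrightarrow> h k i \<le> m k" for k
    using s(1)[of k] by (auto simp: s_eq P_def)
  have Qk: "N k < N (Suc k)" "l k < l (Suc k)" "m k \<le> m (Suc k)" "\<forall>i\<le>N k. h (Suc k) i = h k i"
    and st: "stage T f F (\<epsilon> k) k (m k) (Suc (N k)) (N (Suc k)) (h (Suc k)) (l (Suc k))" for k
    using s(2)[of k] by (simp_all add: s_eq Q_def)
  have N: "strict_mono N" and l: "strict_mono l" and m: "mono m"
    using Qk by (auto simp: strict_mono_Suc_iff mono_iff_le_Suc)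
  have h_Suc: "h (Suc k) i = h k i" if "i \<le> N k" for k i
    using Qk(4)[of k] that by blast
  have h_le: "h k' i = h k i" if "k \<le> k'" "i \<le> N k" for k k' i
    using that(1)
  proof (induction k' rule: dec_induct)
    case (step k')
    have "i \<le> N k'" using that(2) strict_mono_leD[OF N step(1)] by simp
    then show ?case using h_Suc step.IH by simp
  qed simp
  \<comment> \<open>Entries of \<open>h k\<close> up to position \<open>N k\<close> never change again, so the diagonal is the limit.\<close>
  define w where "w = (\<lambda>i. h (Suc i) i)"
  have w: "h k i = w i" if "i \<le> N k" for k i
  proof (cases "k \<le> Suc i")
    case True
    then show ?thesis using h_le[OF True that] by (simp add: w_def)
  next
    case False
    have "i \<le> N (Suc i)" using seq_suble[OF N, of "Suc i"] by simp
    then show ?thesis using h_le[of "Suc i" k i] False by (simp add: w_def)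
  qed
  \<comment> \<open>Sequences that obey the construction from stage \<open>k\<close> on. Since later stages also avoid the
    earlier exceptional sets, such sequences lie in \<open>G\<close> whatever their beginning is within the
    bound \<open>m k\<close>.\<close>
  define K where "K = (\<lambda>k. {z. \<forall>k'\<ge>k. (\<forall>i<Suc (N k'). z i \<le> m k') \<and>
      agree {Suc (N k')..<N (Suc k')} z (h (Suc k'))})"
  have K_G: "z \<in> G" if "z \<in> K k" for z k
  proof -
    have "z \<notin> T n" for n
    proof -
      define k' where "k' = max k n"
      have "\<forall>i<Suc (N k'). z i \<le> m k'" "agree {Suc (N k')..<N (Suc k')} z (h (Suc k'))"
        using that by (auto simp: K_def k'_def)
      moreover have "n \<le> k'" by (simp add: k'_def)
      ultimately show ?thesis using st[of k'] unfolding stage_def by blast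
    qed
    then show ?thesis by (simp add: G_def)
  qed
  have K_splice: "splice (Suc (N k)) r z \<in> K k"
    if "z \<in> K k" "\<forall>i<Suc (N k). r i \<le> m k" for k z r
    unfolding K_def
  proof (intro CollectI allI impI conjI)
    fix k' i assume "k \<le> k'" "i < Suc (N k')"
    then show "splice (Suc (N k)) r z i \<le> m k'"
      using that monoD[OF m \<open>k \<le> k'\<close>] by (auto simp: splice_def K_def intro: order_trans)
  next
    fix k' assume k': "k \<le> k'"
    then have "\<not> i < Suc (N k)" if "Suc (N k') \<le> i" for i
      using strict_mono_leD[OF N k'] that by simp
    then show "agree {Suc (N k')..<N (Suc k')} (splice (Suc (N k)) r z) (h (Suc k'))"
      using that(1) k' by (simp add: splice_def K_def agree_def)
  qed
  have K_robust: "robust (Suc (N k)) (m k) (- (\<Union>n. T n)) z" if "z \<in> K k" for k z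
    using that K_G[OF K_splice[OF that]] by (auto simp: robust_def K_def G_def)
  have place_N: "place N w a (N k) = a k" for a k
    using strict_mono_imp_inj_on[OF N] by (simp add: place_def)
  have place_w: "place N w a i = w i" if "i \<notin> range N" for a i
    using that by (simp add: place_def)
  have place_K: "place N w a \<in> K k" if a: "\<And>i. a i \<le> b (N i)" for a k
    unfolding K_def
  proof (intro CollectI allI impI conjI)
    fix k' i assume i: "i < Suc (N k')"
    show "place N w a i \<le> m k'"
    proof (cases "i \<in> range N")
      case True
      then obtain k'' where k'': "i = N k''" by blast
      then have "k'' \<le> k'" using i strict_mono_less_eq[OF N, of k'' k'] by simp
      then have "a k'' \<le> m k'" using a[of k''] Pk(1)[of k''] monoD[OF m] by (meson order_trans)
      then show ?thesis by (simp add: k'' place_N)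
    next
      case False
      then have "i < N k'" using i by (metis less_SucE rangeI)
      then show ?thesis using False Pk(2)[of i k'] w[of i k'] by (simp add: place_w)
    qed
  next
    fix k'
    have "place N w a i = h (Suc k') i" if i: "Suc (N k') \<le> i" "i < N (Suc k')" for i
    proof -
      have "i \<notin> range N"
      proof
        assume "i \<in> range N"
        then obtain k'' where "i = N k''" by blast
        then show False using i strict_mono_less[OF N, of k' k''] strict_mono_less[OF N, of k'' "Suc k'"]
          by simp
      qed
      then show ?thesis using i w[of i "Suc k'"] by (simp add: place_w)
    qed
    then show "agree {Suc (N k')..<N (Suc k')} (place N w a) (h (Suc k'))"
      by (simp add: agree_def)
  qed
  have early: "(\<Sum>i\<in>S. \<bar>f z i - f z' i\<bar>) \<le> \<epsilon> k"
    if "z \<in> K k" "z' \<in> K k" "agree {Suc (N k)..} z z'" "S \<in> F" "S \<subseteq> {l (Suc k)..}" for z z' k S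
  proof -
    have "agree {Suc (N k)..<N (Suc k)} z (h (Suc k))" using that(1) by (simp add: K_def)
    then show ?thesis
      using st[of k] that K_robust[of z k] K_robust[of z' k] unfolding stage_def by blast
  qed
  have late: "(\<Sum>i<l (Suc k). \<bar>f z i - f z' i\<bar>) \<le> \<epsilon> k"
    if "z \<in> K k" "z' \<in> K k" "agree {..<N (Suc k)} z z'" for z z' k
  proof -
    have "agree {Suc (N k)..<N (Suc k)} z (h (Suc k))" using that(1) by (simp add: K_def)
    then show ?thesis
      using st[of k] that K_robust[of z k] K_robust[of z' k] unfolding stage_def by blast
  qed
  show ?thesis
  proof (rule that[OF N l])
    fix a a' k S
    assume a: "\<And>i. a i \<le> b (N i)" "\<And>i. a' i \<le> b (N i)" "a k = a' k"
      and S: "S \<in> F" "S \<subseteq> {l k..<l (Suc k)}"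
    \<comment> \<open>Change \<open>a\<close> into \<open>a'\<close> in two moves: first the entries before \<open>k\<close>, then those after \<open>k\<close>.\<close>
    define a'' where "a'' = (\<lambda>i. if i < k then a' i else a i)"
    have a'': "a'' i \<le> b (N i)" for i using a by (simp add: a''_def)
    have 1: "(\<Sum>i\<in>S. \<bar>f (place N w a) i - f (place N w a'') i\<bar>) \<le> (1 / 2) ^ k"
    proof (cases k)
      case 0
      then have "a'' = a" by (simp add: a''_def)
      then show ?thesis by simp
    next
      case (Suc k0)
      have "place N w a'' i = place N w a i" if i: "Suc (N k0) \<le> i" for i
      proof (cases "i \<in> range N")
        case True
        then obtain k' where "i = N k'" by blast
        then show ?thesis using i strict_mono_less[OF N, of k0 k'] by (simp add: place_N a''_def Suc)
      qed (simp add: place_w)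
      moreover have "S \<subseteq> {l (Suc k0)..}" using S(2) by (auto simp: Suc)
      ultimately show ?thesis
        using early[OF place_K place_K, of a a'' k0 S] a a'' S by (auto simp: \<epsilon>_def Suc agree_def)
    qed
    have "place N w a' i = place N w a'' i" if i: "i < N (Suc k)" for i
    proof (cases "i \<in> range N")
      case True
      then obtain k' where "i = N k'" by blast
      then show ?thesis
        using i strict_mono_less[OF N, of k' "Suc k"] a(3) by (cases "k' = k") (auto simp: place_N a''_def)
    qed (simp add: place_w)
    then have "(\<Sum>i<l (Suc k). \<bar>f (place N w a'') i - f (place N w a') i\<bar>) \<le> \<epsilon> k"
      using late[OF place_K place_K, of a'' a' k] a a'' by (simp add: agree_def)
    moreover have "(\<Sum>i\<in>S. \<bar>f (place N w a'') i - f (place N w a') i\<bar>)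
        \<le> (\<Sum>i<l (Suc k). \<bar>f (place N w a'') i - f (place N w a') i\<bar>)"
      using S by (intro sum_mono2) auto
    moreover have "\<epsilon> k \<le> (1 / 2) ^ k" by (simp add: \<epsilon>_def)
    ultimately have "(\<Sum>i\<in>S. \<bar>f (place N w a'') i - f (place N w a') i\<bar>) \<le> (1 / 2) ^ k"
      by linarith
    moreover have "(\<Sum>i\<in>S. \<bar>f (place N w a) i - f (place N w a') i\<bar>)
      \<le> (\<Sum>i\<in>S. \<bar>f (place N w a) i - f (place N w a'') i\<bar> + \<bar>f (place N w a'') i - f (place N w a') i\<bar>)"
      by (intro sum_mono) linarith
    ultimately show "(\<Sum>i\<in>S. \<bar>f (place N w a) i - f (place N w a') i\<bar>) \<le> 2 * (1 / 2) ^ k"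
      using 1 by (simp add: sum.distrib)
  qed
qed

section \<open>Membership in c0 and l1 read off from blocks\<close>

text \<open>The norm with which the block \<open>J\<close> contributes to \<open>tail_small F\<close>: the supremum norm on \<open>J\<close> for
  sets with at most one element, the sum norm on \<open>J\<close> for all finite sets.\<close>

definition block_norm :: "nat set set \<Rightarrow> nat set \<Rightarrow> (nat \<Rightarrow> real) \<Rightarrow> real" where
  "block_norm F J v = Max ((\<lambda>S. \<Sum>i\<in>S. \<bar>v i\<bar>) ` {S \<in> F. S \<subseteq> J})"

lemma block_norm_le_iff:
  assumes "finite J" "{} \<in> F"
  shows "block_norm F J v \<le> c \<longleftrightarrow> (\<forall>S\<in>F. S \<subseteq> J \<longrightarrow> (\<Sum>i\<in>S. \<bar>v i\<bar>) \<le> c)"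
proof -
  have "finite {S \<in> F. S \<subseteq> J}"
    by (rule finite_subset[of _ "Pow J"]) (use assms in auto)
  moreover have "{S \<in> F. S \<subseteq> J} \<noteq> {}" using assms by auto
  ultimately show ?thesis by (subst block_norm_def, subst Max_le_iff) auto
qed

lemma sum_le_block_norm:
  assumes "finite J" "S \<in> F" "{} \<in> F" "S \<subseteq> J"
  shows "(\<Sum>i\<in>S. \<bar>v i\<bar>) \<le> block_norm F J v"
  using block_norm_le_iff[of J F v "block_norm F J v"] assms by auto

lemma block_norm_nonneg:
  assumes "finite J" "{} \<in> F"
  shows "0 \<le> block_norm F J v"
  using sum_le_block_norm[of J "{}" F v] assms by simp

lemma block_norm_triangle:
  assumes "finite J" "{} \<in> F"
  shows "block_norm F J (\<lambda>i. u i - w i) \<le> block_norm F J (\<lambda>i. u i - v i) + block_norm F J (\<lambda>i. v i - w i)"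
  unfolding block_norm_le_iff[OF assms]
proof (intro ballI impI)
  fix S assume S: "S \<in> F" "S \<subseteq> J"
  have "(\<Sum>i\<in>S. \<bar>u i - w i\<bar>) \<le> (\<Sum>i\<in>S. \<bar>u i - v i\<bar> + \<bar>v i - w i\<bar>)"
    by (intro sum_mono) linarith
  also have "\<dots> \<le> block_norm F J (\<lambda>i. u i - v i) + block_norm F J (\<lambda>i. v i - w i)"
    using sum_le_block_norm[OF assms(1) S(1) assms(2) S(2)] by (simp add: sum.distrib add_mono)
  finally show "(\<Sum>i\<in>S. \<bar>u i - w i\<bar>) \<le> block_norm F J (\<lambda>i. u i - v i) + block_norm F J (\<lambda>i. v i - w i)" .
qed

lemma block_norm_commute: "block_norm F J (\<lambda>i. u i - v i) = block_norm F J (\<lambda>i. v i - u i)"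
  by (simp add: block_norm_def abs_minus_commute)

lemma block_norm_refl:
  assumes "finite J" "{} \<in> F"
  shows "block_norm F J (\<lambda>i. u i - u i) = 0"
  using block_norm_nonneg[OF assms, of "\<lambda>i. u i - u i"] block_norm_le_iff[OF assms, of "\<lambda>i. u i - u i" 0]
  by simp

text \<open>What the reduction argument uses about c0 and l1. The block axiom says that cutting the
  coordinates into consecutive finite blocks and passing to the norms of the blocks does not change
  membership. The last axiom absorbs the errors of the stabilization; its constant 4 is twice the
  constant there, one for each of two sequences.\<close>

locale blockwise_space =
  fixes L :: "(nat \<Rightarrow> real) set" and F :: "nat set set"
  assumes finite_F: "S \<in> F \<Longrightarrow> finite S"
    and empty_F: "{} \<in> F"
    and tail: "v \<in> L \<Longrightarrow> v \<in> tail_small F"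
    and blocks: "strict_mono l \<Longrightarrow> v \<in> L \<longleftrightarrow> (\<lambda>k. block_norm F {l k..<l (Suc k)} v) \<in> L"
    and perturb: "u \<in> L \<Longrightarrow> (\<And>k. \<bar>v k\<bar> \<le> \<bar>u k\<bar> + 4 * (1 / 2) ^ k) \<Longrightarrow> v \<in> L"

lemma block_index:
  fixes l :: "nat \<Rightarrow> nat"
  assumes "strict_mono l" "l 0 \<le> i"
  obtains k where "l k \<le> i" "i < l (Suc k)"
proof -
  define k where "k = (LEAST k. i < l (Suc k))"
  have "i < l (Suc i)" using seq_suble[OF assms(1), of "Suc i"] by simp
  then have k: "i < l (Suc k)" unfolding k_def by (rule LeastI)
  moreover have "l k \<le> i"
  proof (cases k)
    case (Suc k')
    then show ?thesis using not_less_Least[of k' "\<lambda>k. i < l (Suc k)"] by (auto simp: k_def not_less)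
  qed (use assms in simp)
  ultimately show ?thesis using that by blast
qed

lemma blockwise_c0: "blockwise_space c0_space {S. finite S \<and> card S \<le> 1}"
proof
  show "finite S" if "S \<in> {S. finite S \<and> card S \<le> 1}" for S :: "nat set" using that by simp
  show "{} \<in> {S::nat set. finite S \<and> card S \<le> 1}" by simp
  have small: "S = {} \<or> (\<exists>i. S = {i})" if "finite S" "card S \<le> 1" for S :: "nat set"
    using that by (metis One_nat_def card_0_eq card_1_singletonE le_SucE le_zero_eq)
  show "v \<in> tail_small {S. finite S \<and> card S \<le> 1}" if "v \<in> c0_space" for v
    unfolding tail_small_def
  proof (intro CollectI allI impI)
    fix \<epsilon> :: real assume "\<epsilon> > 0"
    with that obtain l where l: "\<And>i. i \<ge> l \<Longrightarrow> \<bar>v i\<bar> < \<epsilon>"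
      by (auto simp: c0_space_def LIMSEQ_iff)
    show "\<exists>l. \<forall>S\<in>{S. finite S \<and> card S \<le> 1}. S \<subseteq> {l..} \<longrightarrow> (\<Sum>i\<in>S. \<bar>v i\<bar>) \<le> \<epsilon>"
    proof (intro exI[of _ l] ballI impI)
      fix S assume "S \<in> {S. finite S \<and> card S \<le> 1}" "S \<subseteq> {l..}"
      then show "(\<Sum>i\<in>S. \<bar>v i\<bar>) \<le> \<epsilon>"
        using small[of S] l \<open>\<epsilon> > 0\<close> by (auto simp: less_imp_le)
    qed
  qed
  fix l :: "nat \<Rightarrow> nat" and v :: "nat \<Rightarrow> real" assume l: "strict_mono l"
  let ?F = "{S::nat set. finite S \<and> card S \<le> 1}"
  let ?B = "\<lambda>k. block_norm ?F {l k..<l (Suc k)} v"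
  have B_nonneg: "0 \<le> ?B k" for k by (rule block_norm_nonneg) auto
  show "v \<in> c0_space \<longleftrightarrow> ?B \<in> c0_space"
  proof
    assume "v \<in> c0_space"
    show "?B \<in> c0_space"
      unfolding c0_space_def LIMSEQ_iff
    proof (intro CollectI allI impI)
      fix \<epsilon> :: real assume \<epsilon>: "\<epsilon> > 0"
      have "v \<longlonglongrightarrow> 0" using \<open>v \<in> c0_space\<close> by (simp add: c0_space_def)
      then have "\<exists>n. \<forall>i\<ge>n. norm (v i - 0) < \<epsilon> / 2"
        by (rule LIMSEQ_D) (use \<epsilon> in simp)
      then obtain n where n: "\<And>i. i \<ge> n \<Longrightarrow> \<bar>v i\<bar> < \<epsilon> / 2" by force
      show "\<exists>n. \<forall>k\<ge>n. norm (?B k - 0) < \<epsilon>"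
      proof (intro exI[of _ n] allI impI)
        fix k assume "n \<le> k"
        then have nk: "n \<le> l k" using seq_suble[OF l, of k] by simp
        have "?B k \<le> \<epsilon> / 2"
        proof (subst block_norm_le_iff; (intro ballI impI)?)
          fix S assume "S \<in> ?F" "S \<subseteq> {l k..<l (Suc k)}"
          then show "(\<Sum>i\<in>S. \<bar>v i\<bar>) \<le> \<epsilon> / 2"
            using small[of S] n nk \<epsilon> by (auto simp: less_imp_le)
        qed auto
        then show "norm (?B k - 0) < \<epsilon>" using B_nonneg[of k] \<epsilon> by simp
      qed
    qed
  next
    assume "?B \<in> c0_space"
    show "v \<in> c0_space"
      unfolding c0_space_def LIMSEQ_iff
    proof (intro CollectI allI impI)
      fix \<epsilon> :: real assume \<epsilon>: "\<epsilon> > 0"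
      have "?B \<longlonglongrightarrow> 0" using \<open>?B \<in> c0_space\<close> by (simp add: c0_space_def)
      then have "\<exists>n. \<forall>k\<ge>n. norm (?B k - 0) < \<epsilon>"
        using \<epsilon> by (rule LIMSEQ_D)
      then obtain n where n: "\<And>k. k \<ge> n \<Longrightarrow> ?B k < \<epsilon>" by force
      show "\<exists>n. \<forall>i\<ge>n. norm (v i - 0) < \<epsilon>"
      proof (intro exI[of _ "l n"] allI impI)
        fix i assume i: "l n \<le> i"
        moreover have "l 0 \<le> i" using i strict_mono_leD[OF l, of 0 n] by simp
        ultimately obtain k where k: "l k \<le> i" "i < l (Suc k)" using block_index[OF l] by blast
        then have "n \<le> k" using i strict_mono_less[OF l, of n "Suc k"] by simp
        then have "?B k < \<epsilon>" by (rule n)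
        moreover have "(\<Sum>j\<in>{i}. \<bar>v j\<bar>) \<le> ?B k"
          by (rule sum_le_block_norm) (use k in auto)
        ultimately show "norm (v i - 0) < \<epsilon>" by simp
      qed
    qed
  qed
next
  fix u v :: "nat \<Rightarrow> real"
  assume u: "u \<in> c0_space" and le: "\<And>k. \<bar>v k\<bar> \<le> \<bar>u k\<bar> + 4 * (1 / 2) ^ k"
  have "(\<lambda>k. (1 / 2 :: real) ^ k) \<longlonglongrightarrow> 0" by (rule LIMSEQ_realpow_zero) auto
  then have "(\<lambda>k. \<bar>u k\<bar> + 4 * (1 / 2) ^ k) \<longlonglongrightarrow> \<bar>0\<bar> + 4 * 0"
    using u unfolding c0_space_def by (intro tendsto_intros) auto
  then have "(\<lambda>k. \<bar>u k\<bar> + 4 * (1 / 2) ^ k) \<longlonglongrightarrow> 0" by simp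
  then have "v \<longlonglongrightarrow> 0"
    by (rule Lim_null_comparison[rotated]) (use le in simp)
  then show "v \<in> c0_space" by (simp add: c0_space_def)
qed

lemma blockwise_l1: "blockwise_space l1_space {S. finite S}"
proof
  show "finite S" if "S \<in> {S. finite S}" for S :: "nat set" using that by simp
  show "{} \<in> {S::nat set. finite S}" by simp
  show "v \<in> tail_small {S. finite S}" if "v \<in> l1_space" for v
    unfolding tail_small_def
  proof (intro CollectI allI impI)
    fix \<epsilon> :: real assume "\<epsilon> > 0"
    with that obtain l where l: "\<And>m n. m \<ge> l \<Longrightarrow> norm (\<Sum>i=m..<n. \<bar>v i\<bar>) < \<epsilon>"
      unfolding l1_space_def summable_Cauchy by blast
    show "\<exists>l. \<forall>S\<in>{S. finite S}. S \<subseteq> {l..} \<longrightarrow> (\<Sum>i\<in>S. \<bar>v i\<bar>) \<le> \<epsilon>"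
    proof (intro exI[of _ l] ballI impI)
      fix S assume S: "S \<in> {S. finite S}" "S \<subseteq> {l..}"
      then obtain n where "\<forall>i\<in>S. i < n" by (auto simp: finite_nat_set_iff_bounded)
      then have "(\<Sum>i\<in>S. \<bar>v i\<bar>) \<le> (\<Sum>i=l..<n. \<bar>v i\<bar>)"
        using S by (intro sum_mono2) auto
      also have "\<dots> < \<epsilon>" using l[of l n] by simp
      finally show "(\<Sum>i\<in>S. \<bar>v i\<bar>) \<le> \<epsilon>" by simp
    qed
  qed
  fix l :: "nat \<Rightarrow> nat" and v :: "nat \<Rightarrow> real" assume l: "strict_mono l"
  have B: "block_norm {S. finite S} {l k..<l (Suc k)} v = (\<Sum>i=l k..<l (Suc k). \<bar>v i\<bar>)" for k
  proof (rule antisym)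
    show "block_norm {S. finite S} {l k..<l (Suc k)} v \<le> (\<Sum>i=l k..<l (Suc k). \<bar>v i\<bar>)"
      by (subst block_norm_le_iff) (auto intro: sum_mono2)
  qed (auto intro: sum_le_block_norm)
  have B_sum: "(\<Sum>k<n. \<Sum>i=l k..<l (Suc k). \<bar>v i\<bar>) = (\<Sum>i=l 0..<l n. \<bar>v i\<bar>)" for n
  proof (induction n)
    case (Suc n)
    have "l 0 \<le> l n" "l n \<le> l (Suc n)" using strict_mono_leD[OF l] by auto
    then show ?case using Suc by (simp add: sum.atLeastLessThan_concat)
  qed simp
  have "summable (\<lambda>i. \<bar>v i\<bar>) \<longleftrightarrow> summable (\<lambda>k. \<Sum>i=l k..<l (Suc k). \<bar>v i\<bar>)"
  proof
    assume s: "summable (\<lambda>i. \<bar>v i\<bar>)"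
    show "summable (\<lambda>k. \<Sum>i=l k..<l (Suc k). \<bar>v i\<bar>)"
    proof (rule bounded_imp_summable)
      fix n
      show "(\<Sum>k\<le>n. \<Sum>i=l k..<l (Suc k). \<bar>v i\<bar>) \<le> (\<Sum>i. \<bar>v i\<bar>)"
        using B_sum[of "Suc n"] sum_le_suminf[OF s, of "{l 0..<l (Suc n)}"]
        by (simp add: lessThan_Suc_atMost)
    qed (auto intro: sum_nonneg)
  next
    assume s: "summable (\<lambda>k. \<Sum>i=l k..<l (Suc k). \<bar>v i\<bar>)"
    have "summable (\<lambda>i. \<bar>v (i + l 0)\<bar>)"
    proof (rule bounded_imp_summable)
      fix n
      have "(\<Sum>i\<le>n. \<bar>v (i + l 0)\<bar>) = (\<Sum>i=l 0..<Suc n + l 0. \<bar>v i\<bar>)"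
        using sum.shift_bounds_nat_ivl[of "\<lambda>i. \<bar>v i\<bar>" 0 "l 0" "Suc n"]
        by (simp add: atLeast0LessThan lessThan_Suc_atMost)
      also have "\<dots> \<le> (\<Sum>i=l 0..<l (Suc n + l 0). \<bar>v i\<bar>)"
        using seq_suble[OF l, of "Suc n + l 0"] by (intro sum_mono2) auto
      also have "\<dots> = (\<Sum>k<Suc n + l 0. \<Sum>i=l k..<l (Suc k). \<bar>v i\<bar>)" by (simp only: B_sum)
      also have "\<dots> \<le> (\<Sum>k. \<Sum>i=l k..<l (Suc k). \<bar>v i\<bar>)"
        by (rule sum_le_suminf[OF s]) (auto intro: sum_nonneg)
      finally show "(\<Sum>i\<le>n. \<bar>v (i + l 0)\<bar>) \<le> (\<Sum>k. \<Sum>i=l k..<l (Suc k). \<bar>v i\<bar>)" .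
    qed simp
    then show "summable (\<lambda>i. \<bar>v i\<bar>)" by (subst (asm) summable_iff_shift)
  qed
  then show "v \<in> l1_space \<longleftrightarrow> (\<lambda>k. block_norm {S. finite S} {l k..<l (Suc k)} v) \<in> l1_space"
    by (simp add: l1_space_def B sum_nonneg)
next
  fix u v :: "nat \<Rightarrow> real"
  assume u: "u \<in> l1_space" and le: "\<And>k. \<bar>v k\<bar> \<le> \<bar>u k\<bar> + 4 * (1 / 2) ^ k"
  have "summable (\<lambda>k. \<bar>u k\<bar> + 4 * (1 / 2) ^ k)"
    using u by (intro summable_add summable_mult summable_geometric) (auto simp: l1_space_def)
  then have "summable (\<lambda>k. \<bar>v k\<bar>)"
    by (rule summable_comparison_test') (use le in simp)
  then show "v \<in> l1_space" by (simp add: l1_space_def)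
qed

section \<open>Grids with pseudometrics force equivalence to c0 or l1\<close>

text \<open>A null sequence is approximated by differences of points of the grids with mesh \<open>1 / M k\<close> in the
  unit interval, with summable error. One of the two points can be taken to be 0, and it depends on
  the sign which one. The finitely many entries that exceed 1 in absolute value are cut off.\<close>

lemma grid_rounding:
  fixes a :: "nat \<Rightarrow> real" and M :: "nat \<Rightarrow> nat"
  assumes a: "a \<longlonglongrightarrow> 0" and M: "\<And>k. 2 ^ k \<le> M k"
  obtains p q where "\<forall>k. p k \<le> M k \<and> q k \<le> M k \<and> (p k = 0 \<or> q k = 0)"
    "summable (\<lambda>k. \<bar>a k - (real (p k) - real (q k)) / M k\<bar>)"
proof -
  define t where "t = (\<lambda>k. nat \<lfloor>min \<bar>a k\<bar> 1 * M k\<rfloor>)"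
  define p where "p = (\<lambda>k. if a k \<ge> 0 then t k else 0)"
  define q where "q = (\<lambda>k. if a k \<ge> 0 then 0 else t k)"
  have M_pos: "0 < real (M k)" for k
    using less_le_trans[OF _ M[of k]] by simp
  have t: "real (t k) \<le> min \<bar>a k\<bar> 1 * M k" "min \<bar>a k\<bar> 1 * M k \<le> real (t k) + 1" for k
  proof -
    have "0 \<le> min \<bar>a k\<bar> 1 * M k" by simp
    then show "real (t k) \<le> min \<bar>a k\<bar> 1 * M k" "min \<bar>a k\<bar> 1 * M k \<le> real (t k) + 1"
      unfolding t_def by linarith+
  qed
  have t_le: "t k \<le> M k" for k
  proof -
    have "min \<bar>a k\<bar> 1 * M k \<le> 1 * real (M k)" by (intro mult_right_mono) auto
    then show ?thesis using t(1)[of k] by simp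
  qed
  have "\<forall>\<^sub>F k in sequentially. \<bar>a k\<bar> < 1"
    using order_tendstoD(2)[OF tendsto_rabs_zero[OF a], of 1] by simp
  then have "\<forall>\<^sub>F k in sequentially. norm \<bar>a k - (real (p k) - real (q k)) / M k\<bar> \<le> (1 / 2) ^ k"
  proof eventually_elim
    case (elim k)
    have "\<bar>a k - (real (p k) - real (q k)) / M k\<bar> = \<bar>\<bar>a k\<bar> - real (t k) / M k\<bar>"
      by (auto simp: p_def q_def abs_if)
    also have "\<dots> = \<bar>\<bar>a k\<bar> * M k - real (t k)\<bar> / M k"
    proof -
      have "\<bar>a k\<bar> - real (t k) / M k = (\<bar>a k\<bar> * M k - real (t k)) / M k"
        using M_pos[of k] by (simp add: field_simps)
      then show ?thesis using M_pos[of k] by (simp add: abs_divide)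
    qed
    also have "\<dots> \<le> 1 / M k"
      using t[of k] elim M_pos[of k] by (intro divide_right_mono) auto
    also have "\<dots> \<le> 1 / 2 ^ k"
      using of_nat_mono[OF M[of k], where 'a = real] by (intro frac_le) simp_all
    finally show ?case by (simp add: power_one_over)
  qed
  then have "summable (\<lambda>k. \<bar>a k - (real (p k) - real (q k)) / M k\<bar>)"
    by (rule summable_comparison_test_ev) (intro summable_geometric, simp)
  then show ?thesis
    using t_le by (intro that[of p q]) (auto simp: p_def q_def)
qed

lemma strict_mono_choice:
  fixes P :: "nat \<Rightarrow> nat \<Rightarrow> bool"
  assumes "\<And>i n. \<exists>k\<ge>n. P i k"
  obtains g where "strict_mono g" "\<And>i. P i (g i)"
proof -
  have "\<exists>g. \<forall>i. P i (g i) \<and> g i < g (Suc i)"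
    by (rule dependent_nat_choice) (use assms[of 0 0] assms[of "Suc _" "Suc _"] in \<open>auto simp: Suc_le_eq\<close>)
  then show ?thesis using that by (auto simp: strict_mono_Suc_iff)
qed

lemma summable_scaleR_unit:
  fixes y :: "nat \<Rightarrow> 'a::banach"
  assumes "\<And>k. norm (y k) = 1" "summable (\<lambda>k. \<bar>a k\<bar>)"
  shows "summable (\<lambda>k. a k *\<^sub>R y k)"
  by (rule summable_norm_cancel) (use assms in simp)

lemma summable_scaleR_unit_tendsto:
  fixes y :: "nat \<Rightarrow> 'a::banach"
  assumes "\<And>k. norm (y k) = 1" "summable (\<lambda>k. a k *\<^sub>R y k)"
  shows "a \<longlonglongrightarrow> 0"
proof -
  have "(\<lambda>k. norm (a k *\<^sub>R y k)) \<longlonglongrightarrow> 0"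
    using summable_LIMSEQ_zero[OF assms(2)] by (rule tendsto_norm_zero)
  then show ?thesis using assms(1) by (simp add: tendsto_rabs_zero_iff)
qed

text \<open>The difference of the two series converges absolutely.\<close>

lemma summable_scaleR_cong:
  fixes y :: "nat \<Rightarrow> 'a::banach"
  assumes "\<And>k. norm (y k) = 1" "summable (\<lambda>k. \<bar>a k - c k\<bar>)"
  shows "summable (\<lambda>k. a k *\<^sub>R y k) \<longleftrightarrow> summable (\<lambda>k. c k *\<^sub>R y k)"
  using summable_add[of "\<lambda>k. c k *\<^sub>R y k" "\<lambda>k. (a k - c k) *\<^sub>R y k"]
    summable_diff[of "\<lambda>k. a k *\<^sub>R y k" "\<lambda>k. (a k - c k) *\<^sub>R y k"]
    summable_scaleR_unit[of y "\<lambda>k. a k - c k"] assms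
  by (auto simp flip: scaleR_add_left scaleR_diff_left)

text \<open>The residue of a Borel reduction after stabilization. Differences of grid points give
  coefficients along the unit vectors \<open>y k\<close>, and convergence of the series is decided by
  pseudometrics that act on each coordinate separately. The last axiom is strong because its left
  side depends on \<open>p k - q k\<close> only, while \<open>D k\<close> is an arbitrary pseudometric.\<close>

locale grid_pseudometrics =
  fixes y :: "nat \<Rightarrow> 'a::banach" and M :: "nat \<Rightarrow> nat" and D :: "nat \<Rightarrow> nat \<Rightarrow> nat \<Rightarrow> real"
    and L :: "(nat \<Rightarrow> real) set"
  assumes norm_y: "norm (y k) = 1" and M_ge: "2 ^ k \<le> M k"
    and D_refl: "D k s s = 0" and D_commute: "D k s t = D k t s"
    and D_triangle: "D k s u \<le> D k s t + D k t u"
    and D_iff: "(\<And>k. p k \<le> M k) \<Longrightarrow> (\<And>k. q k \<le> M k) \<Longrightarrow>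
      summable (\<lambda>k. ((real (p k) - real (q k)) / M k) *\<^sub>R y k) \<longleftrightarrow> (\<lambda>k. D k (p k) (q k)) \<in> L"
begin

lemma D_nonneg: "0 \<le> D k s t"
  using D_triangle[of k s s t] D_commute[of k s t] D_refl[of k s] by simp

lemma M_pos: "0 < real (M k)"
  using less_le_trans[OF _ M_ge[of k]] by simp

text \<open>A null sequence of coefficients gives \<open>D k (p k) (q k)\<close> tending to 0: otherwise these distances
  stay above some \<open>\<epsilon>\<close> along a subsequence on which the coefficients are absolutely summable, although
  the series restricted to that subsequence converges. So every null sequence of coefficients gives
  a convergent series.\<close>

lemma equivalent_to_c0:
  assumes L: "L = c0_space"
  shows "summable (\<lambda>k. a k *\<^sub>R y k) \<longleftrightarrow> a \<in> c0_space"
proof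
  show "a \<in> c0_space" if "summable (\<lambda>k. a k *\<^sub>R y k)"
    using summable_scaleR_unit_tendsto[OF norm_y that] by (simp add: c0_space_def)
next
  assume "a \<in> c0_space"
  then have a: "a \<longlonglongrightarrow> 0" by (simp add: c0_space_def)
  obtain p q where pq0: "\<forall>k. p k \<le> M k \<and> q k \<le> M k \<and> (p k = 0 \<or> q k = 0)"
    and diff: "summable (\<lambda>k. \<bar>a k - (real (p k) - real (q k)) / M k\<bar>)"
    by (rule grid_rounding[OF a M_ge])
  have pq: "p k \<le> M k" "q k \<le> M k" for k
    using spec[OF pq0, of k] by simp_all
  define c where "c = (\<lambda>k. (real (p k) - real (q k)) / M k)"
  have "(\<lambda>k. a k - (a k - c k)) \<longlonglongrightarrow> 0 - 0"
    using a summable_LIMSEQ_zero[OF diff] by (intro tendsto_diff) (simp_all add: c_def tendsto_rabs_zero_iff)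
  then have c: "c \<longlonglongrightarrow> 0" by simp
  have "(\<lambda>k. D k (p k) (q k)) \<longlonglongrightarrow> 0"
  proof (rule ccontr)
    assume "\<not> ?thesis"
    then obtain \<epsilon> where \<epsilon>: "\<epsilon> > 0" "\<And>n. \<exists>k\<ge>n. \<epsilon> \<le> D k (p k) (q k)"
      using D_nonneg by (auto simp: LIMSEQ_iff not_less)
    have "\<exists>k\<ge>n. \<epsilon> \<le> D k (p k) (q k) \<and> \<bar>c k\<bar> \<le> (1 / 2) ^ i" for i n
    proof -
      have "(1 / 2 :: real) ^ i > 0" by simp
      with c have "\<exists>n'. \<forall>k\<ge>n'. norm (c k - 0) < (1 / 2) ^ i" by (rule LIMSEQ_D)
      then obtain n' where n': "\<And>k. k \<ge> n' \<Longrightarrow> \<bar>c k\<bar> < (1 / 2) ^ i" by force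
      from \<epsilon>(2)[of "max n n'"] obtain k where "k \<ge> max n n'" "\<epsilon> \<le> D k (p k) (q k)" by blast
      then show ?thesis using n'[of k] by (intro exI[of _ k]) auto
    qed
    then obtain g where g: "strict_mono g" "\<And>i. \<epsilon> \<le> D (g i) (p (g i)) (q (g i)) \<and> \<bar>c (g i)\<bar> \<le> (1 / 2) ^ i"
      using strict_mono_choice[of "\<lambda>i k. \<epsilon> \<le> D k (p k) (q k) \<and> \<bar>c k\<bar> \<le> (1 / 2) ^ i"] by blast
    define p' where "p' = (\<lambda>k. if k \<in> range g then p k else 0)"
    define q' where "q' = (\<lambda>k. if k \<in> range g then q k else 0)"
    define c' where "c' = (\<lambda>k. (real (p' k) - real (q' k)) / M k)"
    have "summable (\<lambda>i. \<bar>c' (g i)\<bar>)"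
    proof (rule summable_comparison_test')
      show "summable (\<lambda>i. (1 / 2 :: real) ^ i)" by (intro summable_geometric) simp
      show "norm \<bar>c' (g i)\<bar> \<le> (1 / 2) ^ i" for i
        using g(2)[of i] by (simp add: c'_def c_def p'_def q'_def)
    qed
    then have "summable (\<lambda>k. \<bar>c' k\<bar>)"
      by (subst (asm) summable_mono_reindex[OF g(1)]) (auto simp: c'_def p'_def q'_def)
    then have "summable (\<lambda>k. c' k *\<^sub>R y k)"
      by (rule summable_scaleR_unit[OF norm_y])
    then have "(\<lambda>k. D k (p' k) (q' k)) \<longlonglongrightarrow> 0"
      using D_iff[of p' q'] pq by (auto simp: c'_def p'_def q'_def L c0_space_def)
    then have "(\<lambda>i. D (g i) (p' (g i)) (q' (g i))) \<longlonglongrightarrow> 0"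
      using LIMSEQ_subseq_LIMSEQ[OF _ g(1)] by (simp add: o_def)
    then have "\<epsilon> \<le> 0"
      by (rule LIMSEQ_le_const) (use g(2) in \<open>auto simp: p'_def q'_def\<close>)
    then show False using \<epsilon>(1) by simp
  qed
  then have "summable (\<lambda>k. c k *\<^sub>R y k)"
    using D_iff[OF pq] by (simp add: c_def L c0_space_def)
  then show "summable (\<lambda>k. a k *\<^sub>R y k)"
    using summable_scaleR_cong[OF norm_y diff] by (simp add: c_def)
qed

text \<open>Otherwise there would be grid points in the upper half of the unit interval whose
  \<open>D\<close>-distances to 0 are summable along a subsequence, and a series of vectors of norm at least 1/2
  would converge.\<close>

lemma D_far_bounded_below:
  assumes L: "L = l1_space"
  shows "\<exists>\<delta>>0. \<exists>K. \<forall>k\<ge>K. \<forall>t. M k \<le> 2 * t \<longrightarrow> t \<le> M k \<longrightarrow> \<delta> \<le> D k t 0"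
proof (rule ccontr)
  assume contra: "\<not> ?thesis"
  have "\<exists>k\<ge>n. \<exists>t. M k \<le> 2 * t \<and> t \<le> M k \<and> D k t 0 < (1 / 2) ^ i" for i n
  proof -
    have "(1 / 2 :: real) ^ i > 0" by simp
    with contra show ?thesis by (meson not_le)
  qed
  then obtain g where g: "strict_mono g"
    "\<And>i. \<exists>t. M (g i) \<le> 2 * t \<and> t \<le> M (g i) \<and> D (g i) t 0 < (1 / 2) ^ i"
    using strict_mono_choice[of "\<lambda>i k. \<exists>t. M k \<le> 2 * t \<and> t \<le> M k \<and> D k t 0 < (1 / 2) ^ i"] by blast
  then obtain t where t: "\<And>i. M (g i) \<le> 2 * t i" "\<And>i. t i \<le> M (g i)" "\<And>i. D (g i) (t i) 0 < (1 / 2) ^ i"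
    by metis
  define p where "p = (\<lambda>k. if k \<in> range g then t (inv g k) else 0)"
  have p_g: "p (g i) = t i" for i
    using strict_mono_imp_inj_on[OF g(1)] by (simp add: p_def)
  have p_0: "p k = 0" if "k \<notin> range g" for k using that by (simp add: p_def)
  have p_le: "p k \<le> M k" for k
    by (cases "k \<in> range g") (auto simp: p_g p_0 t(2))
  have "summable (\<lambda>i. D (g i) (p (g i)) 0)"
  proof (rule summable_comparison_test')
    show "summable (\<lambda>i. (1 / 2 :: real) ^ i)" by (intro summable_geometric) simp
    show "norm (D (g i) (p (g i)) 0) \<le> (1 / 2) ^ i" for i
      using t(3)[of i] D_nonneg by (simp add: p_g less_imp_le)
  qed
  then have "summable (\<lambda>k. D k (p k) 0)"
    by (subst (asm) summable_mono_reindex[OF g(1)]) (simp_all add: p_0 D_refl)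
  then have "summable (\<lambda>k. ((real (p k) - real 0) / M k) *\<^sub>R y k)"
    using D_iff[of p "\<lambda>_. 0"] p_le D_nonneg by (simp add: L l1_space_def)
  then have "(\<lambda>k. (real (p k) - real 0) / M k) \<longlonglongrightarrow> 0"
    by (rule summable_scaleR_unit_tendsto[OF norm_y])
  then have "(\<lambda>i. (real (p (g i)) - real 0) / M (g i)) \<longlonglongrightarrow> 0"
    using LIMSEQ_subseq_LIMSEQ[OF _ g(1)] by (simp add: o_def)
  moreover have "1 / 2 \<le> (real (p (g i)) - real 0) / M (g i)" for i
    using t(1)[of i] M_pos[of "g i"] by (simp add: p_g field_simps flip: of_nat_mult)
  ultimately have "1 / 2 \<le> (0::real)"
    by (intro LIMSEQ_le_const) auto
  then show False by simp
qed

lemma D_path: "D k (n * t) 0 \<le> (\<Sum>i<n. D k (Suc i * t) (i * t))"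
proof (induction n)
  case (Suc n)
  then show ?case using D_triangle[of k "Suc n * t" 0 "n * t"] by simp
qed (simp add: D_refl)

text \<open>Suppose that the series with coefficients \<open>a\<close> converges, and round \<open>a k\<close> to \<open>t\<close> mesh units.
  Walking from 0 in steps of length \<open>t\<close> crosses at least half of the grid in at most \<open>M k / t\<close>
  steps and covers a \<open>D\<close>-distance of at least \<open>\<delta>\<close>, so by the triangle inequality one step has
  \<open>D\<close>-length at least \<open>\<delta> * t / M k\<close>. Convergence depends on the difference of the two grid points
  only, so each \<open>a k\<close> may be represented by such a long step. The \<open>D\<close>-lengths are then summable and
  dominate \<open>\<delta> * \<bar>a k\<bar>\<close> up to the rounding error.\<close>

lemma equivalent_to_l1:
  assumes L: "L = l1_space"
  shows "summable (\<lambda>k. a k *\<^sub>R y k) \<longleftrightarrow> a \<in> l1_space"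
proof
  show "summable (\<lambda>k. a k *\<^sub>R y k)" if "a \<in> l1_space"
    using that by (intro summable_scaleR_unit norm_y) (simp add: l1_space_def)
next
  assume sum_a: "summable (\<lambda>k. a k *\<^sub>R y k)"
  then have a: "a \<longlonglongrightarrow> 0" by (rule summable_scaleR_unit_tendsto[OF norm_y])
  obtain p q where pq0: "\<forall>k. p k \<le> M k \<and> q k \<le> M k \<and> (p k = 0 \<or> q k = 0)"
    and diff: "summable (\<lambda>k. \<bar>a k - (real (p k) - real (q k)) / M k\<bar>)"
    by (rule grid_rounding[OF a M_ge])
  have pq: "p k \<le> M k" "q k \<le> M k" "p k = 0 \<or> q k = 0" for k
    using spec[OF pq0, of k] by simp_all
  define c where "c = (\<lambda>k. (real (p k) - real (q k)) / M k)"
  have sum_c: "summable (\<lambda>k. c k *\<^sub>R y k)"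
    using summable_scaleR_cong[OF norm_y diff] sum_a by (simp add: c_def)
  obtain \<delta> K where \<delta>: "\<delta> > 0"
    and far: "\<forall>k\<ge>K. \<forall>t. M k \<le> 2 * t \<longrightarrow> t \<le> M k \<longrightarrow> \<delta> \<le> D k t 0"
    using D_far_bounded_below[OF L] by blast
  have "\<exists>p' q'. p' \<le> M k \<and> q' \<le> M k \<and> real p' - real q' = real (p k) - real (q k)
    \<and> (K \<le> k \<longrightarrow> \<delta> * \<bar>c k\<bar> \<le> D k p' q')" for k
  proof -
    define t where "t = p k + q k"
    have c_t: "\<bar>c k\<bar> = real t / M k"
      using pq(3)[of k] M_pos[of k] by (auto simp: c_def t_def)
    have t_le: "t \<le> M k" using pq[of k] by (auto simp: t_def)
    show ?thesis
    proof (cases "K \<le> k \<and> t > 0")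
      case False
      then show ?thesis
        using pq[of k] c_t D_nonneg[of k "p k" "q k"] by (intro exI[of _ "p k"] exI[of _ "q k"]) auto
    next
      case True
      define n where "n = M k div t"
      have nt: "n * t \<le> M k" by (simp add: n_def)
      have n_pos: "n > 0" using t_le True by (simp add: n_def div_greater_zero_iff)
      have "M k < n * t + t"
        using mod_less_divisor[of t "M k"] True div_mult_mod_eq[of "M k" t] unfolding n_def by linarith
      moreover have "t \<le> n * t" using n_pos by simp
      ultimately have "M k \<le> 2 * (n * t)" by linarith
      then have "\<delta> \<le> D k (n * t) 0" using far nt True by blast
      also have "\<dots> \<le> (\<Sum>i<n. D k (Suc i * t) (i * t))" by (rule D_path)
      finally have sum_ge: "\<delta> \<le> (\<Sum>i<n. D k (Suc i * t) (i * t))" .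
      have "\<exists>i<n. \<delta> / n \<le> D k (Suc i * t) (i * t)"
      proof (rule ccontr)
        assume "\<not> ?thesis"
        then have "(\<Sum>i<n. D k (Suc i * t) (i * t)) < (\<Sum>i<n. \<delta> / n)"
          using n_pos by (intro sum_strict_mono) (auto simp: not_le)
        then show False using sum_ge n_pos by simp
      qed
      then obtain i where i: "i < n" "\<delta> / n \<le> D k (Suc i * t) (i * t)" by blast
      have "real n * real t \<le> M k" using nt by (simp flip: of_nat_mult)
      then have "\<delta> * \<bar>c k\<bar> \<le> \<delta> / n"
        using \<delta> n_pos M_pos[of k] by (simp add: c_t field_simps)
      then have D_ge: "\<delta> * \<bar>c k\<bar> \<le> D k (Suc i * t) (i * t)" using i(2) by linarith
      have Suc_le: "Suc i * t \<le> M k"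
        using mult_le_mono1[of "Suc i" n t] i(1) nt by simp
      then have i_le: "i * t \<le> M k" by simp
      show ?thesis
      proof (cases "q k = 0")
        case True
        then show ?thesis
          using Suc_le i_le D_ge by (intro exI[of _ "Suc i * t"] exI[of _ "i * t"]) (simp add: t_def algebra_simps)
      next
        case False
        then have "p k = 0" using pq(3)[of k] by simp
        then show ?thesis
          using Suc_le i_le D_ge D_commute[of k "Suc i * t" "i * t"]
          by (intro exI[of _ "i * t"] exI[of _ "Suc i * t"]) (simp add: t_def algebra_simps)
      qed
    qed
  qed
  then obtain p' q' where p'q': "\<And>k. p' k \<le> M k" "\<And>k. q' k \<le> M k"
    "\<And>k. real (p' k) - real (q' k) = real (p k) - real (q k)"
    "\<And>k. K \<le> k \<Longrightarrow> \<delta> * \<bar>c k\<bar> \<le> D k (p' k) (q' k)"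
    by metis
  have "summable (\<lambda>k. D k (p' k) (q' k))"
    using D_iff[OF p'q'(1,2)] sum_c D_nonneg by (simp add: p'q'(3) c_def L l1_space_def)
  then have "summable (\<lambda>k. \<delta> * \<bar>c k\<bar>)"
    by (rule summable_comparison_test'[where N = K]) (use p'q'(4) \<delta> in \<open>simp add: abs_mult\<close>)
  then have "summable (\<lambda>k. \<bar>c k\<bar>)" using \<delta> by (simp add: summable_cmult_iff)
  then have "summable (\<lambda>k. \<bar>c k\<bar> + \<bar>a k - c k\<bar>)"
    using diff unfolding c_def by (rule summable_add)
  then have "summable (\<lambda>k. \<bar>a k\<bar>)"
    by (rule summable_comparison_test') (simp add: abs_le_iff, linarith)
  then show "a \<in> l1_space" by (simp add: l1_space_def)
qed

end

section \<open>From a Borel reduction to pseudometrics on finite grids\<close>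

text \<open>The sequences of natural numbers are embedded so that in position \<open>i\<close> the numbers up to \<open>2 ^ i\<close>
  form a grid of mesh \<open>2 ^ (-i)\<close> in the unit interval of the line through \<open>x i\<close>. The reduction
  composed with this embedding is stabilized. Then \<open>D k s t\<close> is the norm of the difference of the
  \<open>k\<close>th blocks of the images of two sequences with \<open>s\<close> and \<open>t\<close> in the \<open>k\<close>th free position and 0 in
  the other ones, and up to \<open>4 * (1 / 2) ^ k\<close> the other entries do not matter.\<close>

theorem (in blockwise_space) reduction_grid_pseudometrics:
  fixes x :: "nat \<Rightarrow> 'a::banach"
  assumes x: "\<And>n. x n \<noteq> 0" and red: "basis_equiv x \<le>\<^sub>B RN_mod L"
  obtains N D where "strict_mono N"
    "grid_pseudometrics (\<lambda>k. sgn (x (N k))) (\<lambda>k. 2 ^ N k) D L"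
proof -
  obtain \<theta> where \<theta>: "\<theta> \<in> borel_measurable borel"
    and \<theta>_iff: "\<And>a b. (a, b) \<in> basis_equiv x \<longleftrightarrow> (\<theta> a, \<theta> b) \<in> RN_mod L"
    using red unfolding borel_reducible_def by blast
  define emb where "emb = (\<lambda>z::nat \<Rightarrow> nat. \<lambda>i. real (z i) / 2 ^ i / norm (x i))"
  define f where "f = (\<lambda>z. \<theta> (emb z))"
  have "continuous_on UNIV (real :: nat \<Rightarrow> real)"
    by (simp add: continuous_on_open_vimage open_discrete)
  then have "continuous_on UNIV (\<lambda>z::nat \<Rightarrow> nat. real (z i))" for i
    by (rule continuous_on_compose2[OF _ continuous_on_product_coordinates]) simp
  then have "continuous_on UNIV emb"
    unfolding emb_def divide_inverse
    by (intro continuous_on_coordinatewise_then_product continuous_on_mult_right)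
  then have "emb \<in> borel_measurable borel"
    by (rule borel_measurable_continuous_onI)
  then have f: "f \<in> borel_measurable borel"
    unfolding f_def using \<theta> by (rule measurable_compose)
  have f_iff: "(\<lambda>i. f z i - f z' i) \<in> L \<longleftrightarrow> summable (\<lambda>i. (emb z i - emb z' i) *\<^sub>R x i)" for z z'
    using \<theta>_iff[of "emb z" "emb z'"] by (simp add: f_def basis_equiv_def RN_mod_def coef_def)
  have f_tail: "(\<lambda>i. f z i - f z' i) \<in> tail_small F" if "\<forall>i\<ge>j. z i = z' i" for z z' j
  proof (rule tail)
    have "summable (\<lambda>i. (emb z i - emb z' i) *\<^sub>R x i)"
      by (rule summable_finite[of "{..<j}"]) (use that in \<open>auto simp: emb_def not_less\<close>)
    then show "(\<lambda>i. f z i - f z' i) \<in> L" by (simp add: f_iff)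
  qed
  obtain N l w where N: "strict_mono N" and l: "strict_mono l"
    and stab: "\<And>a a' k S. (\<And>i. a i \<le> 2 ^ N i) \<Longrightarrow> (\<And>i. a' i \<le> 2 ^ N i) \<Longrightarrow> a k = a' k \<Longrightarrow>
       S \<in> F \<Longrightarrow> S \<subseteq> {l k..<l (Suc k)} \<Longrightarrow>
       (\<Sum>i\<in>S. \<bar>f (place N w a) i - f (place N w a') i\<bar>) \<le> 2 * (1 / 2) ^ k"
    by (rule borel_stabilization[OF f finite_F f_tail, where b = "\<lambda>i. 2 ^ i"]) auto
  define B where "B = (\<lambda>k a a'. block_norm F {l k..<l (Suc k)} (\<lambda>i. f (place N w a) i - f (place N w a') i))"
  define unit where "unit = (\<lambda>(k::nat) s j. if j = k then s else (0::nat))"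
  define D where "D = (\<lambda>k s t. B k (unit k s) (unit k t))"
  have B_nonneg: "0 \<le> B k a a'" for k a a'
    unfolding B_def by (intro block_norm_nonneg empty_F) auto
  have B_triangle: "B k a c \<le> B k a b + B k b c" for k a b c
    unfolding B_def by (intro block_norm_triangle empty_F) auto
  have B_commute: "B k a b = B k b a" for k a b
    unfolding B_def by (rule block_norm_commute)
  have B_stab: "B k a (unit k (a k)) \<le> 2 * (1 / 2) ^ k" if "\<And>k. a k \<le> 2 ^ N k" for a k
    unfolding B_def
  proof (subst block_norm_le_iff; (intro ballI impI)?)
    fix S assume "S \<in> F" "S \<subseteq> {l k..<l (Suc k)}"
    then show "(\<Sum>i\<in>S. \<bar>f (place N w a) i - f (place N w (unit k (a k))) i\<bar>) \<le> 2 * (1 / 2) ^ k"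
      using that by (intro stab) (auto simp: unit_def)
  qed (auto simp: empty_F)
  have "grid_pseudometrics (\<lambda>k. sgn (x (N k))) (\<lambda>k. 2 ^ N k) D L"
  proof
    show "norm (sgn (x (N k))) = 1" for k using x by (simp add: norm_sgn)
    show "(2::nat) ^ k \<le> 2 ^ N k" for k
      using seq_suble[OF N] by (intro power_increasing) auto
    show "D k s s = 0" for k s
      unfolding D_def B_def by (intro block_norm_refl empty_F) auto
    show "D k s t = D k t s" for k s t unfolding D_def by (rule B_commute)
    show "D k s u \<le> D k s t + D k t u" for k s t u unfolding D_def by (rule B_triangle)
    fix p q :: "nat \<Rightarrow> nat" assume p: "\<And>k. p k \<le> 2 ^ N k" and q: "\<And>k. q k \<le> 2 ^ N k"
    have emb_N: "emb (place N w a) (N k) = real (a k) / 2 ^ N k / norm (x (N k))" for a k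
      using strict_mono_imp_inj_on[OF N] by (simp add: emb_def place_def)
    have "summable (\<lambda>k. ((real (p k) - real (q k)) / 2 ^ N k) *\<^sub>R sgn (x (N k)))
      \<longleftrightarrow> summable (\<lambda>k. (emb (place N w p) (N k) - emb (place N w q) (N k)) *\<^sub>R x (N k))"
      by (simp add: emb_N sgn_div_norm divide_inverse algebra_simps)
    also have "\<dots> \<longleftrightarrow> summable (\<lambda>i. (emb (place N w p) i - emb (place N w q) i) *\<^sub>R x i)"
      by (rule summable_mono_reindex[OF N]) (simp add: emb_def place_def)
    also have "\<dots> \<longleftrightarrow> (\<lambda>i. f (place N w p) i - f (place N w q) i) \<in> L"
      by (simp add: f_iff)
    also have "\<dots> \<longleftrightarrow> (\<lambda>k. B k p q) \<in> L"
      unfolding B_def by (rule blocks[OF l])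
    also have "\<dots> \<longleftrightarrow> (\<lambda>k. D k (p k) (q k)) \<in> L"
    proof -
      have "B k p q \<le> D k (p k) (q k) + 4 * (1 / 2) ^ k" "D k (p k) (q k) \<le> B k p q + 4 * (1 / 2) ^ k" for k
        using B_stab[OF p, of k] B_stab[OF q, of k]
          B_triangle[of k p q "unit k (p k)"] B_triangle[of k "unit k (p k)" q "unit k (q k)"]
          B_triangle[of k "unit k (p k)" "unit k (q k)" p] B_triangle[of k p "unit k (q k)" q]
          B_commute[of k q "unit k (q k)"] B_commute[of k p "unit k (p k)"]
        unfolding D_def by linarith+
      moreover have "0 \<le> D k s t" for k s t by (simp add: D_def B_nonneg)
      ultimately show ?thesis
        using perturb[of "\<lambda>k. B k p q" "\<lambda>k. D k (p k) (q k)"] perturb[of "\<lambda>k. D k (p k) (q k)" "\<lambda>k. B k p q"]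
          B_nonneg by (auto simp: abs_of_nonneg)
    qed
    finally show "summable (\<lambda>k. ((real (p k) - real (q k)) / real (2 ^ N k)) *\<^sub>R sgn (x (N k))) \<longleftrightarrow>
       (\<lambda>k. D k (p k) (q k)) \<in> L" by simp
  qed
  then show ?thesis by (rule that[OF N])
qed

section \<open>The reduction in the other direction\<close>

text \<open>If the coefficient space of a normalized subsequence is \<open>L\<close>, then placing coefficients along this
  subsequence is a continuous linear reduction.\<close>

lemma RN_mod_reducible_to_basis_equiv:
  fixes x :: "nat \<Rightarrow> 'a::banach"
  assumes N: "strict_mono N"
    and L: "\<And>a. summable (\<lambda>k. a k *\<^sub>R sgn (x (N k))) \<longleftrightarrow> a \<in> L"
  shows "RN_mod L \<le>\<^sub>B basis_equiv x"
proof -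
  define \<phi> where "\<phi> = (\<lambda>(a::nat \<Rightarrow> real) i. if i \<in> range N then a (inv N i) / norm (x i) else 0)"
  have \<phi>_N: "\<phi> a (N k) = a k / norm (x (N k))" for a k
    using strict_mono_imp_inj_on[OF N] by (simp add: \<phi>_def)
  have "(\<lambda>a. \<phi> a i) \<in> borel_measurable borel" for i
    by (cases "i \<in> range N") (simp_all add: \<phi>_def)
  then have "\<phi> \<in> borel_measurable borel"
    by (rule measurable_coordinatewise_then_product)
  moreover have "(a, b) \<in> RN_mod L \<longleftrightarrow> (\<phi> a, \<phi> b) \<in> basis_equiv x" for a b
  proof -
    have "(\<phi> a, \<phi> b) \<in> basis_equiv x \<longleftrightarrow> summable (\<lambda>i. (\<phi> a i - \<phi> b i) *\<^sub>R x i)"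
      by (simp add: basis_equiv_def RN_mod_def coef_def)
    also have "\<dots> \<longleftrightarrow> summable (\<lambda>k. (\<phi> a (N k) - \<phi> b (N k)) *\<^sub>R x (N k))"
      by (rule summable_mono_reindex[OF N, symmetric]) (simp add: \<phi>_def)
    also have "\<dots> \<longleftrightarrow> summable (\<lambda>k. (a k - b k) *\<^sub>R sgn (x (N k)))"
      by (simp add: \<phi>_N sgn_div_norm divide_inverse algebra_simps)
    finally show ?thesis by (simp add: L RN_mod_def)
  qed
  ultimately show ?thesis
    unfolding borel_reducible_def by blast
qed

lemma schauder_basis_nonzero:
  assumes "schauder_basis x"
  shows "x n \<noteq> 0"
proof
  assume "x n = 0"
  have uniq: "a = b" if "(\<lambda>n. a n *\<^sub>R x n) sums 0" "(\<lambda>n. b n *\<^sub>R x n) sums 0" for a b :: "nat \<Rightarrow> real"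
    using assms that unfolding schauder_basis_def by blast
  have "(\<lambda>k. (if k = n then 1 else 0) *\<^sub>R x k) = (\<lambda>_. 0)"
    using \<open>x n = 0\<close> by auto
  then have "(\<lambda>k. if k = n then 1 else 0) = (\<lambda>k. 0::real)"
    by (intro uniq) simp_all
  from fun_cong[OF this, of n] show False by simp
qed

theorem theorem4p3:
  fixes x :: "nat \<Rightarrow> 'a::banach"
  assumes "schauder_basis x"
  shows "(basis_equiv x \<le>\<^sub>B RN_mod c0_space \<longrightarrow> basis_equiv x \<sim>\<^sub>B RN_mod c0_space) \<and>
         (basis_equiv x \<le>\<^sub>B RN_mod l1_space \<longrightarrow> basis_equiv x \<sim>\<^sub>B RN_mod l1_space)"
proof (intro conjI impI)
  assume red: "basis_equiv x \<le>\<^sub>B RN_mod c0_space"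
  obtain N D where N: "strict_mono N"
    and D: "grid_pseudometrics (\<lambda>k. sgn (x (N k))) (\<lambda>k. 2 ^ N k) D c0_space"
    by (rule blockwise_space.reduction_grid_pseudometrics
          [OF blockwise_c0 schauder_basis_nonzero[OF assms] red])
  have "RN_mod c0_space \<le>\<^sub>B basis_equiv x"
    by (rule RN_mod_reducible_to_basis_equiv[OF N grid_pseudometrics.equivalent_to_c0[OF D refl]])
  with red show "basis_equiv x \<sim>\<^sub>B RN_mod c0_space" by (simp add: borel_bireducible_def)
next
  assume red: "basis_equiv x \<le>\<^sub>B RN_mod l1_space"
  obtain N D where N: "strict_mono N"
    and D: "grid_pseudometrics (\<lambda>k. sgn (x (N k))) (\<lambda>k. 2 ^ N k) D l1_space"
    by (rule blockwise_space.reduction_grid_pseudometrics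
          [OF blockwise_l1 schauder_basis_nonzero[OF assms] red])
  have "RN_mod l1_space \<le>\<^sub>B basis_equiv x"
    by (rule RN_mod_reducible_to_basis_equiv[OF N grid_pseudometrics.equivalent_to_l1[OF D refl]])
  with red show "basis_equiv x \<sim>\<^sub>B RN_mod l1_space" by (simp add: borel_bireducible_def)
qed

end
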